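(* Let $2\leq k\leq n-1$. Let $T\subset\Pi$ be the stratum defined by a multiplicity vector $(m_1,\ldots,m_q)$ (positive integers with sum $n$), and suppose that $m_i<k$ for all $i$. Fix a point $G\in T$ and suppose that at $G$ exactly $s$ among the distinct roots $y_1<\ldots<y_q$ of $P$ are of class B. Then in a neighbourhood of the point $G$ the set $D(0,k)\cap T$ is locally the union of $s$ smooth codimension $1$ subvarieties of $T$ intersecting transversally at $G$.
   Context: A real monic polynomial in one real variable is called hyperbolic if all its roots are real. For $a=(a_1,\ldots,a_n)\in{\bf R}^n$ set $P(x,a)=x^n+a_1x^{n-1}+\ldots+a_n$; the hyperbolicity domain is $\Pi=\{a\in{\bf R}^n\mid P(\cdot,a)\text{ is hyperbolic}\}$. $P^{(k)}$ denotes the $k$-th derivative of $P$ with respect to $x$. The stratum $T$ of $\Pi$ defined by the multiplicity vector $(m_1,\ldots,m_q)$ is the set of all polynomials in $\Pi$ having exactly $q$ distinct roots $y_1<\ldots<y_q$, with $y_i$ of multiplicity $m_i$ for every $i$. It is known that $T$ is a smooth variety of dimension $q$ in ${\bf R}^n$. A root of $P$ is of class B if it has multiplicity $<k$ as a root of $P$ and coincides with a root of $P^{(k)}$; all other roots of $P$ are of class A. The discriminant set is $D(i,j)=\{a\in{\bf R}^n\mid {\rm Res}(P^{(i)},P^{(j)})=0\}$, where ${\rm Res}$ is the resultant with respect to $x$ and $P^{(0)}=P$. Smooth codimension $1$ subvarieties of $T$ through $G$ intersect transversally at $G$ if the differentials at $G$ of their local defining equations on $T$ are linearly independent. *)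

theory Defs
  imports "HOL-Analysis.Analysis" "Subresultants.Resultant_Prelim"
begin

section \<open>Smooth hypersurfaces of a subset of a Euclidean space\<close>

text \<open>In finite dimension this is the usual C^r condition on an open set, by iterated
  directional derivatives.\<close>

fun Ck_on :: "nat \<Rightarrow> 'a::euclidean_space set \<Rightarrow> ('a \<Rightarrow> 'b::real_normed_vector) \<Rightarrow> bool" where
  "Ck_on 0 S f \<longleftrightarrow> continuous_on S f"
| "Ck_on (Suc r) S f \<longleftrightarrow> (\<forall>x\<in>S. f differentiable (at x)) \<and>
     (\<forall>v. Ck_on r S (\<lambda>x. frechet_derivative f (at x) v))"

definition smooth_on :: "'a::euclidean_space set \<Rightarrow> ('a \<Rightarrow> 'b::real_normed_vector) \<Rightarrow> bool" where
  "smooth_on S f \<longleftrightarrow> open S \<and> (\<forall>r. Ck_on r S f)"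

text \<open>Velocities at \<open>p\<close> of the smooth curves lying in \<open>M\<close>; the tangent space when \<open>M\<close> is
  an embedded smooth submanifold.\<close>

definition tangent_space :: "'a::euclidean_space set \<Rightarrow> 'a \<Rightarrow> 'a set" where
  "tangent_space M p = {v. \<exists>\<gamma> \<epsilon>. \<epsilon> > 0 \<and> smooth_on {-\<epsilon><..<\<epsilon>} \<gamma> \<and> \<gamma> ` {-\<epsilon><..<\<epsilon>} \<subseteq> M \<and>
     \<gamma> (0::real) = p \<and> (\<gamma> has_vector_derivative v) (at 0)}"

text \<open>The function \<open>f\<close> is defined on an ambient neighbourhood of \<open>p\<close> and represents the smooth
  function that it induces on \<open>M\<close>; the differential at \<open>p\<close> of the latter is the restriction of
  \<open>frechet_derivative f (at p)\<close> to the tangent space of \<open>M\<close>.\<close>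

definition local_defining_equation ::
  "'a::euclidean_space set \<Rightarrow> 'a set \<Rightarrow> 'a \<Rightarrow> ('a \<Rightarrow> real) \<Rightarrow> bool" where
  "local_defining_equation M V p f \<longleftrightarrow>
     (\<exists>W. p \<in> W \<and> smooth_on W f \<and> V \<inter> W = {x \<in> M \<inter> W. f x = 0}) \<and>
     (\<exists>v\<in>tangent_space M p. frechet_derivative f (at p) v \<noteq> 0)"

definition smooth_hypersurface_of :: "'a::euclidean_space set \<Rightarrow> 'a set \<Rightarrow> bool" where
  "smooth_hypersurface_of M V \<longleftrightarrow> V \<subseteq> M \<and> closedin (top_of_set M) V \<and>
     (\<forall>p\<in>V. \<exists>f. local_defining_equation M V p f)"

text \<open>The differentials of two local defining equations of the same hypersurface at \<open>p\<close> are
  nonzero multiples of each other, so the choice of \<open>f\<close> does not matter.\<close>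

definition transversal_at ::
  "'a::euclidean_space set \<Rightarrow> 'i set \<Rightarrow> ('i \<Rightarrow> 'a set) \<Rightarrow> 'a \<Rightarrow> bool" where
  "transversal_at M I V p \<longleftrightarrow> (\<forall>i\<in>I. p \<in> V i) \<and>
     (\<exists>f. (\<forall>i\<in>I. local_defining_equation M (V i) p (f i)) \<and>
       (\<forall>c. (\<forall>v\<in>tangent_space M p. (\<Sum>i\<in>I. c i * frechet_derivative (f i) (at p) v) = 0)
          \<longrightarrow> (\<forall>i\<in>I. c i = 0)))"


section \<open>Hyperbolic polynomials\<close>

text \<open>The index type \<open>'n\<close> has no canonical order, so the numbering of the coordinates
  \<open>a\<^sub>1, \<dots>, a\<^sub>n\<close> of a point of \<open>real ^ 'n\<close> is a parameter: \<open>a\<^sub>i\<close> is the component at \<open>e i\<close>, where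
  \<open>bij_betw e {1..CARD('n)} UNIV\<close>.\<close>

definition monic_poly :: "(nat \<Rightarrow> 'n::finite) \<Rightarrow> real ^ 'n \<Rightarrow> real poly" where
  "monic_poly e a =
     monom 1 CARD('n) + (\<Sum>i=1..CARD('n). monom (vec_nth a (e i)) (CARD('n) - i))"

definition hyperbolic :: "real poly \<Rightarrow> bool" where
  "hyperbolic p \<longleftrightarrow> (\<forall>z. poly (map_poly complex_of_real p) z = 0 \<longrightarrow> z \<in> \<real>)"

definition hyperbolicity_domain :: "(nat \<Rightarrow> 'n::finite) \<Rightarrow> (real ^ 'n) set" where
  "hyperbolicity_domain e = {a. hyperbolic (monic_poly e a)}"

definition stratum :: "(nat \<Rightarrow> 'n::finite) \<Rightarrow> nat \<Rightarrow> (nat \<Rightarrow> nat) \<Rightarrow> (real ^ 'n) set" where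
  "stratum e q m = {a \<in> hyperbolicity_domain e. \<exists>y.
     strict_mono_on {1..q} y \<and> {x. poly (monic_poly e a) x = 0} = y ` {1..q} \<and>
     (\<forall>i\<in>{1..q}. order (y i) (monic_poly e a) = m i)}"

definition class_B :: "nat \<Rightarrow> real poly \<Rightarrow> real \<Rightarrow> bool" where
  "class_B k p x \<longleftrightarrow> poly p x = 0 \<and> order x p < k \<and> poly ((pderiv ^^ k) p) x = 0"

definition discriminant_set :: "(nat \<Rightarrow> 'n::finite) \<Rightarrow> nat \<Rightarrow> nat \<Rightarrow> (real ^ 'n) set" where
  "discriminant_set e i j =
     {a. resultant ((pderiv ^^ i) (monic_poly e a)) ((pderiv ^^ j) (monic_poly e a)) = 0}"

end

theory Submission
  imports Defs "Subresultants.Subresultant_Gcd" "HOL-Computational_Algebra.Field_as_Ring"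
    "HOL-Computational_Algebra.Fundamental_Theorem_Algebra"
begin

text \<open>
  The roots \<open>y_1 < \<dots> < y_q\<close> are coordinates on the stratum \<open>T\<close>, by \<open>P = \<Prod> (X - y_i)^(m_i)\<close>. The
  resultant of \<open>P\<close> and \<open>P^(k)\<close> vanishes iff one of the \<open>f_i = P^(k)(y_i)\<close> does
  (\<open>resultant_root_poly_eq_0_iff\<close>). Near \<open>G\<close> only those \<open>f_i\<close> matter for which \<open>y_i\<close> is of class B at \<open>G\<close>,
  and \<open>D(0,k) \<inter> T\<close> is the union of their zero sets. Smoothness of these sets and their transversality both
  follow from the linear independence of the differentials of those \<open>f_i\<close> that vanish at a given point.

  With \<open>Q_j = P / (X - y_j)\<close>, the partial derivative of \<open>f_i\<close> with respect to \<open>y_j\<close> is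
  \<open>\<delta>_ij P^(k+1)(y_i) - m_j Q_j^(k)(y_i)\<close>. If \<open>f_i = 0\<close>, this is \<open>P^(k+1)(y_i) (\<delta>_ij - A_ij)\<close>, where \<open>A_ij\<close> is
  the speed at which the root of \<open>P^(k)\<close> at \<open>y_i\<close> follows a motion of \<open>y_j\<close>. A hyperbolic polynomial drags the
  roots of its derivatives along: all \<open>A_ij\<close> are positive, by the Laguerre inequality
  \<open>F F'' \<le> F'^2\<close> for \<open>F = Q_j^(k-1)\<close> and because \<open>Q_j^(k)(y_i) = 0\<close> would force \<open>m_i > k\<close>
  (\<open>root_speed_sign\<close>). Translating all roots gives \<open>\<Sum>_j A_ij = 1\<close>. The largest root \<open>y_q\<close> is never of class B
  (\<open>last_root_not_root_of_derivative\<close>), so the rows of \<open>A\<close> restricted to the class B indices have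
  sum less than \<open>1\<close>; \<open>I - A\<close> is diagonally dominant, and the differentials are independent
  (\<open>root_differentials_independent\<close>).

  The \<open>f_i\<close> must be smooth functions on an open set of the ambient space, where a multiple root \<open>y_i\<close> does not
  persist. It is a simple root of \<open>P^(m_i - 1)\<close>, though, and as such extends to a smooth function of all
  coefficients (\<open>smooth_simple_root\<close>). On \<open>T\<close> the extension agrees with the \<open>i\<close>-th root since the roots of
  polynomials in \<open>T\<close> depend continuously on the coefficients (\<open>roots_continuous_on_stratum\<close>).
\<close>

section \<open>Functions of class C^r\<close>

lemma Ck_on_continuous: "Ck_on r S f \<Longrightarrow> continuous_on S f"
  by (cases r) (auto intro!: continuous_at_imp_continuous_on differentiable_imp_continuous_within)

lemma Ck_on_cong:
  assumes "open S" and "\<And>x. x \<in> S \<Longrightarrow> f x = g x" and "Ck_on r S f"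
  shows "Ck_on r S g"
  using assms(2,3)
proof (induction r arbitrary: f g)
  case 0
  then show ?case
    using continuous_on_cong by fastforce
next
  case (Suc r)
  have der: "(g has_derivative frechet_derivative f (at x)) (at x)" if "x \<in> S" for x
  proof (rule has_derivative_transform_within_open[OF _ \<open>open S\<close> that])
    show "(f has_derivative frechet_derivative f (at x)) (at x)"
      using Suc.prems(2) that frechet_derivative_works by auto
  qed (use Suc.prems in auto)
  have "Ck_on r S (\<lambda>x. frechet_derivative g (at x) v)" for v
  proof (rule Suc.IH)
    show "Ck_on r S (\<lambda>x. frechet_derivative f (at x) v)"
      using Suc.prems by simp
    show "frechet_derivative f (at x) v = frechet_derivative g (at x) v" if "x \<in> S" for x
      using frechet_derivative_at[OF der[OF that]] by simp
  qed
  with der show ?case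
    by (auto simp: differentiable_def)
qed

text \<open>One class of differentiability is gained by exhibiting any formula for the derivative;
  it need not be phrased through \<open>frechet_derivative\<close>. Closure under sums, products
  and inverses and the smoothness of implicitly defined roots are inductions with this rule as step.\<close>

lemma Ck_on_SucI:
  assumes "open S" and "\<And>x. x \<in> S \<Longrightarrow> (f has_derivative D x) (at x)"
    and "\<And>v. Ck_on r S (\<lambda>x. D x v)"
  shows "Ck_on (Suc r) S f"
proof -
  have "Ck_on r S (\<lambda>x. frechet_derivative f (at x) v)" for v
    using assms(1) _ assms(3)[of v]
    by (rule Ck_on_cong) (simp add: frechet_derivative_at[OF assms(2)])
  then show ?thesis
    using assms(2) by (auto simp: differentiable_def)
qed

lemma Ck_on_mono: "Ck_on (Suc r) S f \<Longrightarrow> Ck_on r S f"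
proof (induction r arbitrary: f)
  case 0
  then show ?case by (metis Ck_on.simps(1) Ck_on_continuous)
next
  case (Suc r)
  then show ?case by (metis Ck_on.simps(2))
qed

lemma Ck_on_subset:
  assumes "Ck_on r S f" and "T \<subseteq> S"
  shows "Ck_on r T f"
  using assms(1)
proof (induction r arbitrary: f)
  case 0
  then show ?case using assms(2) by (simp add: continuous_on_subset)
next
  case (Suc r)
  then show ?case using assms(2) by auto
qed

lemma Ck_on_const:
  assumes "open S"
  shows "Ck_on r S (\<lambda>x. c)"
proof (induction r arbitrary: c)
  case (Suc r)
  have D: "((\<lambda>x. c) has_derivative (\<lambda>v. 0)) (at x)" for x :: 'a by simp
  show ?case
    by (rule Ck_on_SucI[OF assms D Suc])
qed simp

lemma Ck_on_bounded_linear: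
  assumes "open S" and "bounded_linear f"
  shows "Ck_on r S f"
proof (cases r)
  case 0
  then show ?thesis
    using assms(2) by (simp add: linear_continuous_on)
next
  case (Suc r')
  have D: "(f has_derivative f) (at x)" for x
    using assms(2) bounded_linear_imp_has_derivative by blast
  show ?thesis unfolding Suc
    by (rule Ck_on_SucI[OF assms(1) D Ck_on_const[OF assms(1)]])
qed

lemma Ck_on_add:
  assumes "open S" "Ck_on r S f" "Ck_on r S g"
  shows "Ck_on r S (\<lambda>x. f x + g x)"
  using assms(2,3)
proof (induction r arbitrary: f g)
  case 0
  then show ?case by (simp add: continuous_on_add)
next
  case (Suc r)
  show ?case
  proof (rule Ck_on_SucI[OF assms(1)])
    show "((\<lambda>x. f x + g x) has_derivative
        (\<lambda>v. frechet_derivative f (at x) v + frechet_derivative g (at x) v)) (at x)" if "x \<in> S" for x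
      using that Suc.prems by (intro has_derivative_add) (auto simp: frechet_derivative_works[symmetric])
    show "Ck_on r S (\<lambda>x. frechet_derivative f (at x) v + frechet_derivative g (at x) v)" for v
      using Suc by auto
  qed
qed

lemma Ck_on_sum:
  assumes "open S" "\<And>i. i \<in> I \<Longrightarrow> Ck_on r S (f i)"
  shows "Ck_on r S (\<lambda>x. \<Sum>i\<in>I. f i x)"
  using assms(2)
proof (induction I rule: infinite_finite_induct)
  case (insert i I)
  then show ?case by (simp add: Ck_on_add[OF assms(1)])
qed (simp_all add: Ck_on_const[OF assms(1)])

lemma Ck_on_bilinear:
  assumes "bounded_bilinear B" and "open S" "Ck_on r S f" "Ck_on r S g"
  shows "Ck_on r S (\<lambda>x. B (f x) (g x))"
  using assms(3,4)
proof (induction r arbitrary: f g)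
  case 0
  then show ?case by (simp add: bounded_bilinear.continuous_on[OF assms(1)])
next
  case (Suc r)
  show ?case
  proof (rule Ck_on_SucI[OF assms(2)])
    show "((\<lambda>x. B (f x) (g x)) has_derivative
        (\<lambda>v. B (f x) (frechet_derivative g (at x) v) + B (frechet_derivative f (at x) v) (g x))) (at x)"
      if "x \<in> S" for x
      using that Suc.prems by (intro bounded_bilinear.FDERIV[OF assms(1)]) (auto simp: frechet_derivative_works[symmetric])
    show "Ck_on r S (\<lambda>x. B (f x) (frechet_derivative g (at x) v) + B (frechet_derivative f (at x) v) (g x))" for v
      using Suc.prems Suc.prems[THEN Ck_on_mono] by (intro Ck_on_add assms(2) Suc.IH) auto
  qed
qed

lemmas Ck_on_mult = Ck_on_bilinear[OF bounded_bilinear_mult]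
lemmas Ck_on_scaleR = Ck_on_bilinear[OF bounded_bilinear_scaleR]

lemma Ck_on_power:
  fixes f :: "'a::euclidean_space \<Rightarrow> real"
  assumes "open S" "Ck_on r S f"
  shows "Ck_on r S (\<lambda>x. f x ^ i)"
  by (induction i) (simp_all add: Ck_on_const Ck_on_mult assms)

lemma Ck_on_inverse:
  fixes f :: "'a::euclidean_space \<Rightarrow> real"
  assumes "open S" "Ck_on r S f" "\<And>x. x \<in> S \<Longrightarrow> f x \<noteq> 0"
  shows "Ck_on r S (\<lambda>x. inverse (f x))"
  using assms(2,3)
proof (induction r)
  case 0
  then show ?case by (simp add: continuous_on_inverse)
next
  case (Suc r)
  show ?case
  proof (rule Ck_on_SucI[OF assms(1)])
    show "((\<lambda>x. inverse (f x)) has_derivative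
        (\<lambda>v. - (inverse (f x) * frechet_derivative f (at x) v * inverse (f x)))) (at x)" if "x \<in> S" for x
      using that Suc.prems by (intro Deriv.has_derivative_inverse) (auto simp: frechet_derivative_works[symmetric])
    have "Ck_on r S (\<lambda>x. inverse (f x))"
      using Suc.IH Suc.prems Ck_on_mono by blast
    then have "Ck_on r S (\<lambda>x. (- 1) * (inverse (f x) * frechet_derivative f (at x) v * inverse (f x)))" for v
      using Suc.prems by (intro Ck_on_mult Ck_on_const assms(1)) auto
    then show "Ck_on r S (\<lambda>x. - (inverse (f x) * frechet_derivative f (at x) v * inverse (f x)))" for v
      by simp
  qed
qed

section \<open>Real-rooted polynomials and the Laguerre inequality\<close>

text \<open>Products of linear factors over the reals: the form of hyperbolicity that admits induction over
  the roots.\<close>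

inductive splits :: "real poly \<Rightarrow> bool" where
  const: "c \<noteq> 0 \<Longrightarrow> splits [:c:]"
| linear: "splits p \<Longrightarrow> splits ([:-a, 1:] * p)"

lemma splits_nonzero: "splits p \<Longrightarrow> p \<noteq> 0"
  by (induction rule: splits.induct) (simp_all del: mult_pCons_left)

lemma splits_one: "splits 1"
  using splits.const[of 1] by simp

lemma splits_smult:
  assumes "splits q" "c \<noteq> 0"
  shows "splits ([:c:] * q)"
  using assms(1)
proof (induction rule: splits.induct)
  case (const d)
  then show ?case using splits.const[of "d * c"] assms(2) by simp
next
  case (linear q a)
  then show ?case using splits.linear[of "[:c:] * q" a] by (subst mult.left_commute)
qed

lemma splits_mult: "splits p \<Longrightarrow> splits q \<Longrightarrow> splits (p * q)"
proof (induction rule: splits.induct)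
  case (linear p a)
  then show ?case using splits.linear[OF linear.IH[OF linear.prems], of a] by (subst mult.assoc)
qed (rule splits_smult)

lemma splits_power: "splits p \<Longrightarrow> splits (p ^ i)"
  by (induction i) (simp_all add: splits_mult splits_one)

lemma splits_prod: "(\<And>i. i \<in> I \<Longrightarrow> splits (f i)) \<Longrightarrow> splits (\<Prod>i\<in>I. f i)"
  by (induction I rule: infinite_finite_induct) (simp_all add: splits_mult splits_one)

abbreviation cpoly :: "real poly \<Rightarrow> complex poly" where
  "cpoly \<equiv> map_poly complex_of_real"

lemma cpoly_mult: "cpoly (p * q) = cpoly p * cpoly q"
  by (rule poly_eqI) (simp add: coeff_mult coeff_map_poly)

lemma poly_cpoly_of_real: "poly (cpoly p) (complex_of_real x) = complex_of_real (poly p x)"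
  by (induction p) (auto simp: map_poly_pCons)

lemma cpoly_pderiv: "cpoly (pderiv p) = pderiv (cpoly p)"
  by (rule poly_eqI) (simp add: coeff_pderiv coeff_map_poly)

lemma hyperbolic_imp_splits:
  assumes "hyperbolic p" "p \<noteq> 0"
  shows "splits p"
  using assms
proof (induction "degree p" arbitrary: p)
  case 0
  then obtain c where "p = [:c:]" by (metis degree_eq_zeroE)
  with 0 show ?case by (simp add: splits.const)
next
  case (Suc d)
  have "\<not> constant (poly (cpoly p))"
    using Suc.hyps(2) by (simp add: constant_degree)
  then obtain z where z: "poly (cpoly p) z = 0"
    using fundamental_theorem_of_algebra by blast
  with Suc.prems(1) have "z \<in> \<real>" unfolding hyperbolic_def by blast
  then obtain x where x: "z = complex_of_real x" by (rule Reals_cases)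
  with z have "poly p x = 0" by (simp add: poly_cpoly_of_real)
  then obtain r where r: "p = [:-x, 1:] * r"
    unfolding poly_eq_0_iff_dvd by (rule dvdE)
  with Suc.prems have "r \<noteq> 0" by auto
  then have "degree p = Suc (degree r)"
    unfolding r by (subst degree_mult_eq) auto
  then have "d = degree r" using Suc.hyps(2) by simp
  moreover have "hyperbolic r"
    using Suc.prems(1) unfolding r hyperbolic_def cpoly_mult poly_mult by simp
  ultimately have "splits r" using Suc.hyps(1) \<open>r \<noteq> 0\<close> by blast
  then show ?case unfolding r by (rule splits.linear)
qed

text \<open>Since \<open>f'/f = \<Sum> 1/(z - a)\<close> and \<open>1/(z - a)\<close> lies in the half plane opposite to that of \<open>z\<close>
  for every real \<open>a\<close>, the sum cannot vanish off the real axis. This is the argument of Gauss and Lucas.\<close>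

lemma splits_nonreal:
  assumes "splits p" "Im z \<noteq> 0"
  shows "poly (cpoly p) z \<noteq> 0 \<and>
    (degree p = 0 \<and> poly (cpoly (pderiv p)) z = 0 \<or>
      Im (poly (cpoly (pderiv p)) z / poly (cpoly p) z) * Im z < 0)"
  using assms(1)
proof (induction rule: splits.induct)
  case (const c)
  then show ?case by (simp add: pderiv_pCons map_poly_pCons)
next
  case (linear p a)
  let ?f = "poly (cpoly p) z" and ?f' = "poly (cpoly (pderiv p)) z"
  have za: "z - complex_of_real a \<noteq> 0" using assms(2) by (auto simp: complex_eq_iff)
  have lin: "cpoly [:-a, 1:] = [:- complex_of_real a, 1:]" by (simp add: map_poly_pCons)
  have f: "poly (cpoly ([:-a, 1:] * p)) z = (z - complex_of_real a) * ?f"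
    unfolding cpoly_mult lin by (simp add: algebra_simps)
  have f': "poly (cpoly (pderiv ([:-a, 1:] * p))) z = (z - complex_of_real a) * ?f' + ?f"
    unfolding cpoly_pderiv unfolding cpoly_mult lin unfolding pderiv_mult by (simp add: algebra_simps pderiv_pCons)
  have q: "((z - complex_of_real a) * ?f' + ?f) / ((z - complex_of_real a) * ?f)
       = ?f' / ?f + inverse (z - complex_of_real a)"
    using za linear.IH by (simp add: add_divide_distrib inverse_eq_divide)
  have "Im (inverse (z - complex_of_real a)) * Im z < 0"
  proof -
    have "Im (inverse (z - complex_of_real a)) * Im z = - ((Im z)\<^sup>2 / (cmod (z - complex_of_real a))\<^sup>2)"
      unfolding cmod_power2 by (simp add: power2_eq_square)
    also have "\<dots> < 0" using za assms(2) by simp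
    finally show ?thesis .
  qed
  moreover have "Im (?f' / ?f) * Im z \<le> 0" using linear.IH by (elim conjE disjE) simp_all
  ultimately have "Im (?f' / ?f + inverse (z - complex_of_real a)) * Im z < 0"
    unfolding plus_complex.sel distrib_right by (rule add_nonpos_neg[rotated])
  then show ?case
    unfolding f f' q using linear.IH za by (intro conjI disjI2) auto
qed

lemma splits_imp_hyperbolic: "splits p \<Longrightarrow> hyperbolic p"
  using splits_nonreal complex_is_Real_iff unfolding hyperbolic_def by blast

lemma splits_pderiv:
  assumes "splits p" "degree p > 0"
  shows "splits (pderiv p)"
proof (rule hyperbolic_imp_splits)
  show "pderiv p \<noteq> 0" using assms(2) by (simp add: pderiv_eq_0_iff)
  show "hyperbolic (pderiv p)"
    unfolding hyperbolic_def
  proof (intro allI impI)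
    fix z assume "poly (cpoly (pderiv p)) z = 0"
    then show "z \<in> \<real>"
      using splits_nonreal[OF assms(1), of z] assms(2) by (auto simp: complex_is_Real_iff)
  qed
qed

lemma splits_higher_pderiv:
  assumes "splits p" "l \<le> degree p"
  shows "splits ((pderiv ^^ l) p)"
  using assms(2)
proof (induction l)
  case (Suc l)
  then show ?case using splits_pderiv[of "(pderiv ^^ l) p"] by (simp add: degree_higher_pderiv)
qed (use assms in simp)

text \<open>The quotient \<open>f'/f\<close> is a sum of terms \<open>1/(x - a)\<close>, each with derivative \<open>-1/(x - a)^2\<close>, so it
  decreases. Clearing the denominator \<open>f^2\<close> extends the inequality to the zeros of \<open>f\<close>, where it
  may degenerate to an equality.\<close>

lemma laguerre_inequality:
  assumes "splits f"
  shows "poly f x * poly (pderiv (pderiv f)) x \<le> (poly (pderiv f) x)\<^sup>2"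
    and "degree f > 0 \<Longrightarrow> poly f x \<noteq> 0 \<Longrightarrow>
      poly f x * poly (pderiv (pderiv f)) x < (poly (pderiv f) x)\<^sup>2"
proof -
  have "poly f x * poly (pderiv (pderiv f)) x \<le> (poly (pderiv f) x)\<^sup>2 \<and>
    (degree f > 0 \<longrightarrow> poly f x \<noteq> 0 \<longrightarrow>
      poly f x * poly (pderiv (pderiv f)) x < (poly (pderiv f) x)\<^sup>2)"
    using assms
  proof (induction rule: splits.induct)
    case (linear f a)
    have d1: "pderiv ([:-a, 1:] * g) = [:-a, 1:] * pderiv g + g" for g :: "real poly"
      unfolding pderiv_mult by (simp add: pderiv_pCons)
    have id: "(poly (pderiv ([:-a, 1:] * f)) x)\<^sup>2
        - poly ([:-a, 1:] * f) x * poly (pderiv (pderiv ([:-a, 1:] * f))) x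
      = (x - a)\<^sup>2 * ((poly (pderiv f) x)\<^sup>2 - poly f x * poly (pderiv (pderiv f)) x) + (poly f x)\<^sup>2"
      unfolding d1 pderiv_add poly_add poly_mult by (simp add: power2_eq_square algebra_simps)
    have "(x - a)\<^sup>2 * ((poly (pderiv f) x)\<^sup>2 - poly f x * poly (pderiv (pderiv f)) x) \<ge> 0"
      using linear by simp
    moreover have "(poly f x)\<^sup>2 > 0" if "poly ([:-a, 1:] * f) x \<noteq> 0"
      using that by (simp del: mult_pCons_left)
    ultimately show ?case using id by (smt (verit) zero_le_power2)
  qed (simp add: pderiv_pCons)
  then show "poly f x * poly (pderiv (pderiv f)) x \<le> (poly (pderiv f) x)\<^sup>2"
    and "degree f > 0 \<Longrightarrow> poly f x \<noteq> 0 \<Longrightarrow>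
      poly f x * poly (pderiv (pderiv f)) x < (poly (pderiv f) x)\<^sup>2" by auto
qed

text \<open>If \<open>f'\<close> and \<open>f''\<close> vanish at \<open>x\<close> while \<open>f\<close> does not, the strict Laguerre inequality reads \<open>0 < 0\<close>.
  So a double root of a derivative is a root of the previous one, and so on down to \<open>f\<close>.\<close>

lemma splits_double_root_of_derivative:
  assumes "splits f" "l \<le> degree f" "0 < l"
    and "poly ((pderiv ^^ (l - 1)) f) x = 0" "poly ((pderiv ^^ l) f) x = 0" "i \<le> l"
  shows "poly ((pderiv ^^ i) f) x = 0"
  using assms(2-)
proof (induction l)
  case (Suc l)
  show ?case
  proof (cases "l = 0")
    case True
    then show ?thesis using Suc.prems by (cases "i = 0") (auto simp: le_Suc_eq)
  next
    case False
    then obtain j where j: "l = Suc j" by (cases l) auto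
    let ?g = "(pderiv ^^ j) f"
    have g: "splits ?g" "degree ?g > 0"
      using splits_higher_pderiv[OF assms(1), of j] Suc.prems j by (auto simp: degree_higher_pderiv)
    have "poly ?g x = 0"
      using laguerre_inequality(2)[OF g, of x] Suc.prems j by auto
    then show ?thesis
      using Suc j by (cases "i = Suc l") auto
  qed
qed simp

lemma higher_pderiv_linear_mult:
  fixes Q :: "real poly"
  shows "poly ((pderiv ^^ k) ([:-a, 1:] * Q)) x
     = (x - a) * poly ((pderiv ^^ k) Q) x + real k * poly ((pderiv ^^ (k - 1)) Q) x"
proof -
  have "(pderiv ^^ k) ([:-a, 1:] * Q)
      = [:-a, 1:] * (pderiv ^^ k) Q + Polynomial.smult (real k) ((pderiv ^^ (k - 1)) Q)"
  proof (induction k)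
    case (Suc k)
    have 0: "Polynomial.smult (real k) (pderiv ((pderiv ^^ (k - 1)) Q)) = Polynomial.smult (real k) ((pderiv ^^ k) Q)"
      by (cases k) auto
    have "(pderiv ^^ Suc k) ([:-a, 1:] * Q)
        = pderiv ([:-a, 1:] * (pderiv ^^ k) Q + Polynomial.smult (real k) ((pderiv ^^ (k - 1)) Q))"
      by (simp only: funpow.simps comp_apply Suc)
    also have "\<dots> = [:-a, 1:] * (pderiv ^^ Suc k) Q + (pderiv ^^ k) Q
        + Polynomial.smult (real k) ((pderiv ^^ k) Q)"
      unfolding pderiv_add pderiv_mult pderiv_smult 0 by (simp add: pderiv_pCons)
    finally show ?case by (simp add: smult_add_left)
  qed simp
  then have "poly ((pderiv ^^ k) ([:-a, 1:] * Q)) x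
      = poly ([:-a, 1:] * (pderiv ^^ k) Q + Polynomial.smult (real k) ((pderiv ^^ (k - 1)) Q)) x"
    by (rule arg_cong)
  also have "\<dots> = (x - a) * poly ((pderiv ^^ k) Q) x + real k * poly ((pderiv ^^ (k - 1)) Q) x"
    by (simp add: algebra_simps)
  finally show ?thesis .
qed

lemma order_higher_pderiv:
  fixes p :: "real poly"
  assumes "p \<noteq> 0" "l \<le> order x p"
  shows "(pderiv ^^ l) p \<noteq> 0" "order x ((pderiv ^^ l) p) = order x p - l"
proof -
  have "(pderiv ^^ l) p \<noteq> 0 \<and> order x ((pderiv ^^ l) p) = order x p - l"
    using assms(2)
  proof (induction l)
    case (Suc l)
    let ?g = "(pderiv ^^ l) p"
    have g: "?g \<noteq> 0" "order x ?g = order x p - l" "poly ?g x = 0"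
      using Suc by (auto simp: order_root)
    then have "degree ?g \<noteq> 0"
      by (metis degree_eq_zeroE mult_zero_right pCons_0_0 poly_pCons poly_0 add.right_neutral)
    then have "pderiv ?g \<noteq> 0" by (simp add: pderiv_eq_0_iff)
    then show ?case using order_pderiv[OF g(1,3)] g(2) by simp
  qed (use assms in simp)
  then show "(pderiv ^^ l) p \<noteq> 0" "order x ((pderiv ^^ l) p) = order x p - l" by auto
qed

lemma higher_pderiv_order_nonzero:
  fixes p :: "real poly"
  assumes "p \<noteq> 0"
  shows "poly ((pderiv ^^ order x p) p) x \<noteq> 0"
  using order_higher_pderiv[OF assms order.refl, of x] by (simp add: order_root)

text \<open>With \<open>P = (X - a) Q\<close>, Leibniz' rule turns \<open>Q^(k) P^(k+1) - P^(k) Q^(k+1)\<close> into \<open>(Q^(k))^2\<close> plus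
  \<open>k\<close> times the Laguerre expression of \<open>Q^(k-1)\<close>. At a root \<open>x\<close> of \<open>P^(k)\<close> the product in question is
  therefore at least \<open>(Q^(k))^2\<close>. If that were zero, \<open>x\<close> would be a double root of \<open>Q^(k-1)\<close>,
  hence a root of \<open>P\<close> of multiplicity above \<open>k\<close>. Up to a positive factor the quotient
  \<open>Q^(k)(x) / P^(k+1)(x)\<close> is the speed at which the root \<open>x\<close> of \<open>P^(k)\<close> follows the root \<open>a\<close> of \<open>P\<close>.\<close>

lemma root_speed_sign:
  assumes "splits Q" "1 \<le> k" "k \<le> degree Q"
    and root: "poly ((pderiv ^^ k) ([:-a, 1:] * Q)) x = 0"
    and ord: "order x ([:-a, 1:] * Q) < k"
  shows "poly ((pderiv ^^ k) Q) x * poly ((pderiv ^^ Suc k) ([:-a, 1:] * Q)) x > 0"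
proof -
  obtain j where j: "k = Suc j" using assms(2) by (cases k) auto
  let ?D = "\<lambda>l. poly ((pderiv ^^ l) Q) x"
  have 0: "(x - a) * ?D k + real k * ?D j = 0"
    using root unfolding higher_pderiv_linear_mult by (simp add: j)
  have 1: "poly ((pderiv ^^ Suc k) ([:-a, 1:] * Q)) x = (x - a) * ?D (Suc k) + real (Suc k) * ?D k"
    unfolding higher_pderiv_linear_mult by simp
  have "splits ((pderiv ^^ j) Q)"
    using assms j by (intro splits_higher_pderiv) auto
  from laguerre_inequality(1)[OF this, of x] have lag: "?D j * ?D (Suc k) \<le> (?D k)\<^sup>2"
    by (simp add: j)
  have "?D k * poly ((pderiv ^^ Suc k) ([:-a, 1:] * Q)) x
      = ?D (Suc k) * ((x - a) * ?D k + real k * ?D j)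
        + real k * ((?D k)\<^sup>2 - ?D j * ?D (Suc k)) + (?D k)\<^sup>2"
    unfolding 1 by (simp add: algebra_simps power2_eq_square)
  also have "\<dots> \<ge> (?D k)\<^sup>2" unfolding 0 using lag by simp
  finally have ge: "(?D k)\<^sup>2 \<le> ?D k * poly ((pderiv ^^ Suc k) ([:-a, 1:] * Q)) x" .
  have "?D k \<noteq> 0"
  proof
    assume k0: "?D k = 0"
    with 0 have j0: "?D j = 0" using j by auto
    have z: "?D i = 0" if "i \<le> k" for i
      using splits_double_root_of_derivative[OF assms(1,3) _ _ k0 that] j0 j by simp
    have "poly ((pderiv ^^ i) ([:-a, 1:] * Q)) x = 0" if "i \<le> k" for i
      unfolding higher_pderiv_linear_mult using z[of i] z[of "i - 1"] that by simp
    moreover have "[:-a, 1:] * Q \<noteq> 0" using splits_nonzero[OF assms(1)] by (simp del: mult_pCons_left)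
    ultimately show False
      using higher_pderiv_order_nonzero[of "[:-a, 1:] * Q" x] ord by (meson less_imp_le)
  qed
  then show ?thesis using ge by (smt (verit) zero_less_power2)
qed

section \<open>Independence of the differentials in root coordinates\<close>

text \<open>The rows of \<open>A\<close> restricted to \<open>B\<close> have sum less than \<open>1\<close>, because the positive column \<open>p\<close> is
  missing. Hence \<open>I - A\<close> is strictly diagonally dominant on \<open>B\<close>, and its left kernel is trivial.\<close>

lemma substochastic_kernel_trivial:
  fixes A :: "'i \<Rightarrow> 'i \<Rightarrow> real"
  assumes "finite J" "B \<subseteq> J" "p \<in> J - B"
    and pos: "\<And>i j. i \<in> B \<Longrightarrow> j \<in> J \<Longrightarrow> 0 < A i j"
    and row: "\<And>i. i \<in> B \<Longrightarrow> (\<Sum>j\<in>J. A i j) = 1"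
    and ker: "\<And>j. j \<in> B \<Longrightarrow> d j = (\<Sum>i\<in>B. d i * A i j)"
  shows "\<forall>i\<in>B. d i = 0"
proof -
  have fin: "finite B" using assms(1,2) finite_subset by blast
  have part: "(\<Sum>j\<in>B. A i j) + A i p \<le> 1" if "i \<in> B" for i
  proof -
    have "(\<Sum>j\<in>B. A i j) + A i p = (\<Sum>j\<in>insert p B. A i j)"
      using assms(3) fin by simp
    also have "\<dots> \<le> (\<Sum>j\<in>J. A i j)"
      using assms(1,2,3) pos[OF that] by (intro sum_mono2) (auto intro: less_imp_le)
    finally show ?thesis using row[OF that] by simp
  qed
  have "(\<Sum>j\<in>B. \<bar>d j\<bar>) \<le> (\<Sum>j\<in>B. \<Sum>i\<in>B. \<bar>d i\<bar> * A i j)"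
  proof (rule sum_mono)
    fix j assume j: "j \<in> B"
    have "\<bar>d j\<bar> \<le> (\<Sum>i\<in>B. \<bar>d i * A i j\<bar>)"
      by (subst ker[OF j]) (rule sum_abs)
    also have "\<dots> = (\<Sum>i\<in>B. \<bar>d i\<bar> * A i j)"
      using j pos assms(2) by (intro sum.cong refl) (auto simp: abs_mult less_imp_le subset_iff)
    finally show "\<bar>d j\<bar> \<le> (\<Sum>i\<in>B. \<bar>d i\<bar> * A i j)" .
  qed
  also have "\<dots> = (\<Sum>i\<in>B. \<bar>d i\<bar> * (\<Sum>j\<in>B. A i j))"
    by (subst sum.swap) (simp add: sum_distrib_left)
  also have "\<dots> \<le> (\<Sum>i\<in>B. \<bar>d i\<bar> * (1 - A i p))"
    using part by (intro sum_mono mult_left_mono) (auto simp: algebra_simps)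
  also have "\<dots> = (\<Sum>i\<in>B. \<bar>d i\<bar>) - (\<Sum>i\<in>B. \<bar>d i\<bar> * A i p)"
    by (simp add: algebra_simps sum_subtractf)
  finally have "(\<Sum>i\<in>B. \<bar>d i\<bar> * A i p) \<le> 0" by simp
  moreover have nn: "0 \<le> \<bar>d i\<bar> * A i p" if "i \<in> B" for i
    using pos[OF that, of p] assms(3) by simp
  moreover have "0 \<le> (\<Sum>i\<in>B. \<bar>d i\<bar> * A i p)" by (intro sum_nonneg nn)
  ultimately have "(\<Sum>i\<in>B. \<bar>d i\<bar> * A i p) = 0" by linarith
  then have "\<bar>d i\<bar> * A i p = 0" if "i \<in> B" for i
    using sum_nonneg_eq_0_iff[OF fin, of "\<lambda>i. \<bar>d i\<bar> * A i p"] nn that by simp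
  moreover have "A i p \<noteq> 0" if "i \<in> B" for i using pos[OF that, of p] assms(3) by simp
  ultimately show ?thesis by simp
qed

definition root_poly :: "nat \<Rightarrow> (nat \<Rightarrow> nat) \<Rightarrow> (nat \<Rightarrow> real) \<Rightarrow> real poly" where
  "root_poly q m y = (\<Prod>i=1..q. [:- y i, 1:] ^ m i)"

definition cofactor_poly :: "nat \<Rightarrow> (nat \<Rightarrow> nat) \<Rightarrow> (nat \<Rightarrow> real) \<Rightarrow> nat \<Rightarrow> real poly" where
  "cofactor_poly q m y j = [:- y j, 1:] ^ (m j - 1) * (\<Prod>i\<in>{1..q} - {j}. [:- y i, 1:] ^ m i)"

lemma splits_linear_factor: "splits [:- a, 1:]"
  using splits.linear[OF splits_one, of a] by simp

lemma splits_root_poly: "splits (root_poly q m y)"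
  unfolding root_poly_def by (intro splits_prod splits_power splits_linear_factor)

lemma splits_cofactor_poly: "splits (cofactor_poly q m y j)"
  unfolding cofactor_poly_def by (intro splits_mult splits_prod splits_power splits_linear_factor)

lemma root_poly_eq_cofactor:
  assumes "j \<in> {1..q}" "0 < m j"
  shows "root_poly q m y = [:- y j, 1:] * cofactor_poly q m y j"
proof -
  have "root_poly q m y = [:- y j, 1:] ^ m j * (\<Prod>i\<in>{1..q} - {j}. [:- y i, 1:] ^ m i)"
    unfolding root_poly_def using assms(1) by (simp only: prod.remove[OF finite_atLeastAtMost])
  also have "[:- y j, 1:] ^ m j = [:- y j, 1:] * [:- y j, 1:] ^ (m j - 1)"
  proof -
    obtain l where "m j = Suc l" using assms(2) gr0_implies_Suc by blast
    then show ?thesis by (simp only: power_Suc diff_Suc_1)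
  qed
  finally show ?thesis unfolding cofactor_poly_def by (simp only: mult.assoc)
qed

lemma monic_root_poly: "degree (root_poly q m y) = (\<Sum>i=1..q. m i)" "lead_coeff (root_poly q m y) = 1"
proof -
  have "degree (root_poly q m y) = (\<Sum>i=1..q. degree ([:- y i, 1:] ^ m i))"
    unfolding root_poly_def by (rule degree_prod_eq_sum_degree) (simp only: power_eq_0_iff pCons_eq_0_iff, simp)
  then show "degree (root_poly q m y) = (\<Sum>i=1..q. m i)"
    by (simp add: degree_power_eq)
  show "lead_coeff (root_poly q m y) = 1"
    unfolding root_poly_def lead_coeff_prod lead_coeff_power by simp
qed

lemma order_root_poly:
  assumes "inj_on y {1..q}" "j \<in> {1..q}"
  shows "order (y j) (root_poly q m y) = m j"
proof -
  let ?R = "\<Prod>i\<in>{1..q} - {j}. [:- y i, 1:] ^ m i"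
  have R: "poly ?R (y j) \<noteq> 0"
  proof -
    have "y j \<noteq> y i" if "i \<in> {1..q} - {j}" for i
      using inj_onD[OF assms(1), of j i] assms(2) that by blast
    then show ?thesis by (simp add: poly_prod)
  qed
  have "root_poly q m y = [:- y j, 1:] ^ m j * ?R"
    unfolding root_poly_def using assms(2) by (simp only: prod.remove[OF finite_atLeastAtMost])
  also have "order (y j) \<dots> = m j"
  proof (subst order_mult)
    have "[:- y j, 1:] ^ m j \<noteq> 0" by (simp only: power_eq_0_iff pCons_eq_0_iff) simp
    moreover have "?R \<noteq> 0" using R by (metis poly_0)
    ultimately show "[:- y j, 1:] ^ m j * ?R \<noteq> 0" by (simp only: mult_eq_0_iff simp_thms not_False_eq_True)
    show "order (y j) ([:- y j, 1:] ^ m j) + order (y j) ?R = m j"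
      by (simp only: order_power_n_n order_0I[OF R])
  qed
  finally show ?thesis .
qed

lemma poly_root_poly_eq_0_iff:
  assumes "\<forall>i\<in>{1..q}. 0 < m i"
  shows "poly (root_poly q m y) x = 0 \<longleftrightarrow> x \<in> y ` {1..q}"
  using assms by (simp only: root_poly_def poly_prod prod_zero_iff finite_atLeastAtMost) auto

lemma pderiv_root_poly:
  "pderiv (root_poly q m y) = (\<Sum>j=1..q. Polynomial.smult (real (m j)) (cofactor_poly q m y j))"
proof -
  have lin: "pderiv [:- a, 1:] = (1 :: real poly)" for a
    by (simp add: pderiv_pCons)
  show ?thesis
    unfolding root_poly_def pderiv_prod cofactor_poly_def
    by (intro sum.cong refl)
      (simp only: pderiv_power lin mult_1_right mult_1_left mult_smult_left mult_smult_right mult.commute)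
qed

text \<open>Expanded in powers of \<open>X - c\<close>, each factor \<open>X - y i\<close> has the nonnegative coefficients \<open>c - y i\<close>
  and \<open>1\<close>.\<close>

lemma derivatives_nonneg_right_of_roots:
  fixes c :: real
  assumes "\<And>i. i \<in> I \<Longrightarrow> y i \<le> c"
  shows "poly ((pderiv ^^ k) (\<Prod>i\<in>I. [:- y i, 1:] ^ m i)) c \<ge> 0"
proof -
  define N where "N f \<longleftrightarrow> (\<forall>k. poly ((pderiv ^^ k) f) c \<ge> 0)" for f :: "real poly"
  have one: "N 1"
  proof -
    have "poly ((pderiv ^^ k) (1 :: real poly)) c \<ge> 0" for k
      by (cases k) (simp_all add: funpow_Suc_right del: funpow.simps)
    then show ?thesis by (simp add: N_def)
  qed
  have lin: "N ([:- a, 1:] * f)" if "a \<le> c" "N f" for a f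
    using that unfolding N_def higher_pderiv_linear_mult by simp
  have pow: "N ([:- a, 1:] ^ l * f)" if "a \<le> c" "N f" for a f l
  proof (induction l)
    case (Suc l)
    then show ?case using lin[OF that(1) Suc] by (simp only: power_Suc mult.assoc)
  qed (use that in simp)
  have "N (\<Prod>i\<in>I. [:- y i, 1:] ^ m i)"
    using assms
  proof (induction I rule: infinite_finite_induct)
    case (insert i I)
    then show ?case unfolding prod.insert[OF insert.hyps] by (intro pow) auto
  qed (simp_all add: one)
  then show ?thesis by (simp add: N_def)
qed

text \<open>At the largest root the derivatives of \<open>Q = P / (X - y 1)\<close> are nonnegative, and in
  \<open>P^(k) = (X - y 1) Q^(k) + k Q^(k-1)\<close> the first term is positive unless \<open>Q^(k)\<close> vanishes there,
  which is excluded by the multiplicities.\<close>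

lemma last_root_not_root_of_derivative:
  assumes m: "\<forall>i\<in>{1..q}. 0 < m i" "\<forall>i\<in>{1..q}. m i < k"
    and k: "k < (\<Sum>i=1..q. m i)" and mono: "strict_mono_on {1..q} y"
  shows "1 \<le> q" "poly ((pderiv ^^ k) (root_poly q m y)) (y q) \<noteq> 0"
proof -
  show q: "1 \<le> q" using k by (cases "q = 0") auto
  \<comment> \<open>For \<open>q = 1\<close> the multiplicity would be \<open>n > k\<close>.\<close>
  have "q \<noteq> 1" using k m q by auto
  with q have q2: "2 \<le> q" by simp
  let ?Q = "cofactor_poly q m y 1"
  have P: "root_poly q m y = [:- y 1, 1:] * ?Q"
    using m q by (intro root_poly_eq_cofactor) auto
  have dQ: "degree ?Q = (\<Sum>i=1..q. m i) - 1"
    using monic_root_poly(1)[of q m y] splits_nonzero[OF splits_cofactor_poly, of q m y 1]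
    unfolding P by (subst (asm) degree_mult_eq) auto
  have le: "y i \<le> y q" if "i \<in> {1..q}" for i
    using mono that by (cases "i = q") (auto simp: strict_mono_on_def less_imp_le)
  have lt: "y 1 < y q" using mono q2 by (auto simp: strict_mono_on_def)
  have nn: "poly ((pderiv ^^ l) ?Q) (y q) \<ge> 0" for l
  proof -
    have "?Q = (\<Prod>i\<in>{1..q}. [:- y i, 1:] ^ (if i = 1 then m 1 - 1 else m i))"
      unfolding cofactor_poly_def using q
      by (subst prod.remove[of "{1..q}" 1]) (auto intro!: arg_cong2[of _ _ _ _ "(*)"] prod.cong)
    then show ?thesis
      using derivatives_nonneg_right_of_roots[of "{1..q}" y "y q" l] le by simp
  qed
  show "poly ((pderiv ^^ k) (root_poly q m y)) (y q) \<noteq> 0"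
  proof
    assume 0: "poly ((pderiv ^^ k) (root_poly q m y)) (y q) = 0"
    have "order (y q) (root_poly q m y) = m q"
      using q mono by (intro order_root_poly) (auto simp: strict_mono_on_imp_inj_on)
    then have "poly ((pderiv ^^ k) ?Q) (y q) * poly ((pderiv ^^ Suc k) (root_poly q m y)) (y q) > 0"
      using 0 m q dQ k
      by (intro root_speed_sign[OF splits_cofactor_poly, of k q m y 1 "y 1" "y q", folded P]) auto
    then have "poly ((pderiv ^^ k) ?Q) (y q) > 0"
      using nn[of k] by (cases "poly ((pderiv ^^ k) ?Q) (y q) = 0") auto
    then have "poly ((pderiv ^^ k) (root_poly q m y)) (y q) > 0"
      unfolding P higher_pderiv_linear_mult using lt nn[of "k - 1"]
      by (intro add_pos_nonneg mult_pos_pos mult_nonneg_nonneg) auto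
    with 0 show False by simp
  qed
qed

text \<open>The coefficient of \<open>c i\<close> is the partial derivative of \<open>P^(k)(y i)\<close> with respect to \<open>y j\<close>. Divided by
  \<open>P^(k+1)(y i)\<close>, it becomes \<open>\<delta>_ij - A i j\<close> with \<open>A i j > 0\<close>. The row sums of \<open>A\<close> over all \<open>j\<close>
  are \<open>1\<close>, which says that translating all roots translates the roots of \<open>P^(k)\<close>. The
  largest root does not belong to \<open>B\<close>, so the diagonal dominance above applies.\<close>

lemma root_differentials_independent:
  assumes m: "\<forall>i\<in>{1..q}. 0 < m i" "\<forall>i\<in>{1..q}. m i < k"
    and k: "1 \<le> k" "k < (\<Sum>i=1..q. m i)" and mono: "strict_mono_on {1..q} y"
    and B: "B \<subseteq> {1..q}" "\<And>i. i \<in> B \<Longrightarrow> poly ((pderiv ^^ k) (root_poly q m y)) (y i) = 0"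
    and dep: "\<And>j. j \<in> {1..q} \<Longrightarrow>
      (\<Sum>i\<in>B. c i * ((if i = j then poly ((pderiv ^^ Suc k) (root_poly q m y)) (y i) else 0)
         - real (m j) * poly ((pderiv ^^ k) (cofactor_poly q m y j)) (y i))) = 0"
  shows "\<forall>i\<in>B. c i = 0"
proof -
  define P where "P = root_poly q m y"
  define w where "w i = poly ((pderiv ^^ Suc k) P) (y i)" for i
  define g where "g i j = real (m j) * poly ((pderiv ^^ k) (cofactor_poly q m y j)) (y i)" for i j
  have inj: "inj_on y {1..q}" using mono by (rule strict_mono_on_imp_inj_on)
  have pos: "g i j * w i > 0" if ij: "i \<in> B" "j \<in> {1..q}" for i j
  proof -
    let ?Q = "cofactor_poly q m y j"
    have P: "P = [:- y j, 1:] * ?Q"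
      unfolding P_def using m ij by (intro root_poly_eq_cofactor) auto
    have dQ: "degree ?Q = (\<Sum>i=1..q. m i) - 1"
      using monic_root_poly(1)[of q m y] splits_nonzero[OF splits_cofactor_poly, of q m y j]
      unfolding P_def[symmetric] P by (subst (asm) degree_mult_eq) auto
    have "order (y i) P < k"
      unfolding P_def using order_root_poly[OF inj, of i] ij B(1) m by auto
    then have "poly ((pderiv ^^ k) ?Q) (y i) * w i > 0"
      using B(2)[OF ij(1)] dQ k unfolding w_def P_def[symmetric]
      by (intro root_speed_sign[OF splits_cofactor_poly, of k q m y j "y j" "y i", folded P]) auto
    then show ?thesis using m ij by (auto simp: g_def mult.assoc)
  qed
  have sum_g: "(\<Sum>j=1..q. g i j) = w i" for i
  proof -
    have "(pderiv ^^ Suc k) P = (pderiv ^^ k) (pderiv P)" by (simp only: funpow_Suc_right comp_apply)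
    then show ?thesis
      unfolding w_def g_def P_def by (simp add: pderiv_root_poly higher_pderiv_sum higher_pderiv_smult poly_sum)
  qed
  have q: "1 \<le> q" "q \<notin> B"
    using last_root_not_root_of_derivative[OF m k(2) mono] B(2) by auto
  have w0: "w i \<noteq> 0" if "i \<in> B" for i using pos[OF that, of q] q by auto
  have "\<forall>i\<in>B. c i * w i = 0"
  proof (rule substochastic_kernel_trivial[where J = "{1..q}" and p = q and A = "\<lambda>i j. g i j / w i"])
    show "0 < g i j / w i" if "i \<in> B" "j \<in> {1..q}" for i j
      using pos[OF that] by (simp add: zero_less_divide_iff zero_less_mult_iff)
    show "(\<Sum>j\<in>{1..q}. g i j / w i) = 1" if "i \<in> B" for i
      using sum_g[of i] w0[OF that] by (simp add: sum_divide_distrib[symmetric])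
    fix j assume j: "j \<in> B"
    have "0 = (\<Sum>i\<in>B. c i * ((if i = j then w i else 0) - g i j))"
      unfolding w_def g_def P_def using dep[of j] B(1) j by (metis subsetD)
    also have "\<dots> = (\<Sum>i\<in>B. (if i = j then c i * w i else 0)) - (\<Sum>i\<in>B. c i * g i j)"
      by (subst sum_subtractf[symmetric]) (auto intro!: sum.cong simp: algebra_simps)
    also have "(\<Sum>i\<in>B. (if i = j then c i * w i else 0)) = c j * w j"
      using j finite_subset[OF B(1)] by simp
    also have "(\<Sum>i\<in>B. c i * g i j) = (\<Sum>i\<in>B. c i * w i * (g i j / w i))"
      using w0 by (intro sum.cong) auto
    finally show "c j * w j = (\<Sum>i\<in>B. c i * w i * (g i j / w i))" by simp
  qed (use B q in auto)
  with w0 show ?thesis by simp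
qed

lemma resultant_root_poly_eq_0_iff:
  assumes "\<forall>i\<in>{1..q}. 0 < m i"
  shows "resultant (root_poly q m y) R = 0 \<longleftrightarrow> (\<exists>i\<in>{1..q}. poly R (y i) = 0)"
proof -
  let ?P = "root_poly q m y"
  have P0: "?P \<noteq> 0" using splits_nonzero[OF splits_root_poly] .
  show ?thesis
  proof
    assume "\<exists>i\<in>{1..q}. poly R (y i) = 0"
    then obtain i where i: "i \<in> {1..q}" "poly R (y i) = 0" by blast
    moreover have "poly ?P (y i) = 0" using i poly_root_poly_eq_0_iff[OF assms] by blast
    ultimately have "[:- y i, 1:] dvd gcd ?P R" by (simp add: poly_eq_0_iff_dvd)
    then have "degree [:- y i, 1:] \<le> degree (gcd ?P R)"
      using P0 by (intro dvd_imp_degree_le) auto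
    then show "resultant ?P R = 0" by (simp add: resultant_0_gcd)
  next
    assume r: "resultant ?P R = 0"
    show "\<exists>i\<in>{1..q}. poly R (y i) = 0"
    proof (rule ccontr)
      assume n: "\<not> (\<exists>i\<in>{1..q}. poly R (y i) = 0)"
      have "coprime [:- y i, 1:] R" if "i \<in> {1..q}" for i
        using n that by (intro prime_elem_imp_coprime prime_elem_linear_field_poly)
          (auto simp: poly_eq_0_iff_dvd)
      then have "coprime ?P R"
        unfolding root_poly_def by (intro prod_coprime_left coprime_power_left_iff[THEN iffD2]) auto
      then show False using r by (simp add: resultant_0_gcd)
    qed
  qed
qed

section \<open>Coefficient vectors and the stratum\<close>

lemma coeff_monic_poly:
  fixes a :: "real ^ 'n::finite"
  shows "coeff (monic_poly e a) k
    = (if k < CARD('n) then a $ e (CARD('n) - k) else if k = CARD('n) then 1 else 0)"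
proof -
  let ?n = "CARD('n)"
  have "coeff (monic_poly e a) k
      = (if k = ?n then 1 else 0) + (\<Sum>i=1..?n. if ?n - i = k then a $ e i else 0)"
    unfolding monic_poly_def by (simp add: coeff_sum coeff_monom)
  also have "(\<Sum>i=1..?n. if ?n - i = k then a $ e i else 0)
      = (if k < ?n then a $ e (?n - k) else 0)"
  proof (cases "k < ?n")
    case True
    have "(\<Sum>i=1..?n. if ?n - i = k then a $ e i else 0)
        = (\<Sum>i=1..?n. if i = ?n - k then a $ e i else 0)"
      using True by (intro sum.cong refl) auto
    then show ?thesis using True by simp
  next
    case False
    then show ?thesis by (intro trans[OF sum.neutral]) auto
  qed
  finally show ?thesis by auto
qed

lemma monic_monic_poly:
  fixes a :: "real ^ 'n::finite"
  shows "degree (monic_poly e a) = CARD('n)" "lead_coeff (monic_poly e a) = 1"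
proof -
  show "degree (monic_poly e a) = CARD('n)"
    by (intro antisym degree_le le_degree) (auto simp: coeff_monic_poly)
  then show "lead_coeff (monic_poly e a) = 1" by (simp add: coeff_monic_poly)
qed

text \<open>For a numbering \<open>e\<close> of the coordinates this is the inverse of \<open>monic_poly e\<close> on monic polynomials
  of degree \<open>CARD('n)\<close>.\<close>

definition coeff_vec :: "(nat \<Rightarrow> 'n::finite) \<Rightarrow> real poly \<Rightarrow> real ^ 'n" where
  "coeff_vec e p = (\<chi> b. coeff p (CARD('n) - inv_into {1..CARD('n)} e b))"

lemma monic_poly_coeff_vec:
  fixes e :: "nat \<Rightarrow> 'n::finite"
  assumes "bij_betw e {1..CARD('n)} UNIV" "degree p = CARD('n)" "lead_coeff p = 1"
  shows "monic_poly e (coeff_vec e p) = p"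
proof (rule poly_eqI)
  fix k
  have "inv_into {1..CARD('n)} e (e (CARD('n) - k)) = CARD('n) - k" if "k < CARD('n)"
    using assms(1) that by (intro inv_into_f_f) (auto simp: bij_betw_def)
  then show "coeff (monic_poly e (coeff_vec e p)) k = coeff p k"
    using assms(2,3) by (auto simp: coeff_monic_poly coeff_vec_def coeff_eq_0)
qed

lemma coeff_vec_monic_poly:
  fixes e :: "nat \<Rightarrow> 'n::finite"
  assumes "bij_betw e {1..CARD('n)} UNIV"
  shows "coeff_vec e (monic_poly e a) = a"
proof -
  have "a $ e (CARD('n) - (CARD('n) - inv_into {1..CARD('n)} e b)) = a $ b"
    and "CARD('n) - inv_into {1..CARD('n)} e b < CARD('n)" for b
  proof -
    have "b \<in> e ` {1..CARD('n)}" using assms by (auto simp: bij_betw_def)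
    then have "inv_into {1..CARD('n)} e b \<in> {1..CARD('n)}" "e (inv_into {1..CARD('n)} e b) = b"
      by (rule inv_into_into, rule f_inv_into_f)
    then show "a $ e (CARD('n) - (CARD('n) - inv_into {1..CARD('n)} e b)) = a $ b"
      and "CARD('n) - inv_into {1..CARD('n)} e b < CARD('n)" by auto
  qed
  then show ?thesis by (simp add: coeff_vec_def coeff_monic_poly vec_eq_iff)
qed

lemma prod_linear_powers_dvd:
  fixes P :: "real poly"
  assumes "finite I" "inj_on y I" "\<And>i. i \<in> I \<Longrightarrow> [:- y i, 1:] ^ m i dvd P"
  shows "(\<Prod>i\<in>I. [:- y i, 1:] ^ m i) dvd P"
  using assms
proof (induction I rule: finite_induct)
  case (insert i I)
  have "coprime [:- y i, 1:] [:- y j, 1:]" if "j \<in> I" for j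
  proof (intro prime_elem_imp_coprime prime_elem_linear_field_poly)
    have "y j \<noteq> y i" using insert.prems(1) insert.hyps(2) that by (metis inj_on_contraD insertCI)
    then show "\<not> [:- y i, 1:] dvd [:- y j, 1:]"
      unfolding poly_eq_0_iff_dvd[symmetric] by simp
  qed simp
  then have "coprime ([:- y i, 1:] ^ m i) (\<Prod>j\<in>I. [:- y j, 1:] ^ m j)"
    by (intro prod_coprime_right coprime_power_left_iff[THEN iffD2] disjI1
        coprime_power_right_iff[THEN iffD2])
  moreover have "(\<Prod>j\<in>I. [:- y j, 1:] ^ m j) dvd P" using insert by auto
  moreover have "[:- y i, 1:] ^ m i dvd P" using insert by auto
  ultimately show ?case unfolding prod.insert[OF insert.hyps] by (intro divides_mult)
qed simp

lemma stratum_iff_root_poly: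
  fixes e :: "nat \<Rightarrow> 'n::finite"
  assumes m: "\<forall>i\<in>{1..q}. 0 < m i" "(\<Sum>i=1..q. m i) = CARD('n)"
  shows "a \<in> stratum e q m \<longleftrightarrow>
    (\<exists>y. strict_mono_on {1..q} y \<and> monic_poly e a = root_poly q m y)"
proof
  assume "a \<in> stratum e q m"
  then obtain y where y: "strict_mono_on {1..q} y"
    and ord: "\<forall>i\<in>{1..q}. order (y i) (monic_poly e a) = m i"
    unfolding stratum_def by blast
  let ?P = "monic_poly e a"
  have "root_poly q m y dvd ?P"
    unfolding root_poly_def
  proof (rule prod_linear_powers_dvd)
    show "[:- y i, 1:] ^ m i dvd ?P" if "i \<in> {1..q}" for i
      using order_1[of "y i" ?P] ord that by metis
  qed (use strict_mono_on_imp_inj_on[OF y] in auto)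
  then obtain r where r: "?P = root_poly q m y * r" by (rule dvdE)
  have lc: "lead_coeff r = 1"
    using monic_monic_poly(2)[of e a] monic_root_poly(2)[of q m y] unfolding r lead_coeff_mult by simp
  then have r0: "r \<noteq> 0" by auto
  have "degree ?P = degree (root_poly q m y) + degree r"
    unfolding r using r0 splits_nonzero[OF splits_root_poly] by (rule degree_mult_eq[rotated])
  then have "degree r = 0" using monic_monic_poly(1)[of e a] monic_root_poly(1)[of q m y] m by simp
  then obtain c where c: "r = [:c:]" by (rule degree_eq_zeroE)
  then have "r = 1" using lc by simp
  then show "\<exists>y. strict_mono_on {1..q} y \<and> ?P = root_poly q m y"
    using y r by auto
next
  assume "\<exists>y. strict_mono_on {1..q} y \<and> monic_poly e a = root_poly q m y"
  then obtain y where y: "strict_mono_on {1..q} y" "monic_poly e a = root_poly q m y" by blast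
  then show "a \<in> stratum e q m"
    unfolding stratum_def hyperbolicity_domain_def
    using poly_root_poly_eq_0_iff[OF m(1), of y] order_root_poly[OF strict_mono_on_imp_inj_on[OF y(1)]]
      splits_imp_hyperbolic[OF splits_root_poly, of q m y]
    by auto
qed

text \<open>The value at \<open>i\<close> is determined by the image: it is the element with exactly \<open>i\<close> elements below or
  equal to it.\<close>

lemma strict_mono_on_same_image:
  fixes y z :: "nat \<Rightarrow> real"
  assumes "strict_mono_on {1..q} y" "strict_mono_on {1..q} z" "y ` {1..q} = z ` {1..q}"
    and "i \<in> {1..q}"
  shows "y i = z i"
proof -
  let ?S = "y ` {1..q}"
  have rank: "card {x \<in> ?S. x \<le> w i} = i"
    if w: "strict_mono_on {1..q} w" "?S = w ` {1..q}" for w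
  proof -
    have "{x \<in> ?S. x \<le> w i} = w ` {1..i}"
      unfolding w(2) using strict_mono_on_less_eq[OF w(1)] assms(4) by (auto simp: image_iff)
    moreover have "inj_on w {1..i}"
      using strict_mono_on_imp_inj_on[OF w(1)] by (rule inj_on_subset) (use assms(4) in auto)
    ultimately show ?thesis by (simp add: card_image)
  qed
  have lt: "\<not> u i < w i"
    if "strict_mono_on {1..q} u" "?S = u ` {1..q}" "strict_mono_on {1..q} w" "?S = w ` {1..q}" for u w
  proof
    assume "u i < w i"
    moreover have "w i \<in> ?S" using that(4) assms(4) by blast
    ultimately have "{x \<in> ?S. x \<le> u i} \<subseteq> {x \<in> ?S. x \<le> w i}"
      "w i \<in> {x \<in> ?S. x \<le> w i}" "w i \<notin> {x \<in> ?S. x \<le> u i}" by auto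
    then have "{x \<in> ?S. x \<le> u i} \<subset> {x \<in> ?S. x \<le> w i}" by blast
    then have "card {x \<in> ?S. x \<le> u i} < card {x \<in> ?S. x \<le> w i}"
      by (intro psubset_card_mono) auto
    then show False unfolding rank[OF that(1,2)] rank[OF that(3,4)] by simp
  qed
  show ?thesis
    using lt[OF assms(1) refl assms(2,3)] lt[OF assms(2,3) assms(1) refl] by linarith
qed

text \<open>The positive multiplicities make the root sets equal; a weakly sorted list of \<open>q\<close> roots that covers
  \<open>q\<close> distinct values has no repetition. This makes the root coordinates injective up to the
  closure of the stratum, where roots might collide.\<close>

lemma weakly_sorted_roots_unique:
  assumes m: "\<forall>i\<in>{1..q}. 0 < m i" and y: "strict_mono_on {1..q} y"
    and z: "\<And>i j. i \<in> {1..q} \<Longrightarrow> j \<in> {1..q} \<Longrightarrow> i \<le> j \<Longrightarrow> z i \<le> z j"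
    and eq: "root_poly q m z = root_poly q m y" and "i \<in> {1..q}"
  shows "z i = y i"
proof -
  have im: "y ` {1..q} = z ` {1..q}"
  proof (rule Set.set_eqI)
    fix x show "x \<in> y ` {1..q} \<longleftrightarrow> x \<in> z ` {1..q}"
      unfolding poly_root_poly_eq_0_iff[OF m, symmetric] eq by (rule refl)
  qed
  have "card (z ` {1..q}) = card {1..q}"
    unfolding im[symmetric] using strict_mono_on_imp_inj_on[OF y] by (rule card_image)
  then have "inj_on z {1..q}" by (intro eq_card_imp_inj_on) auto
  have "strict_mono_on {1..q} z"
  proof (rule strict_mono_onI)
    fix i j :: nat assume ij: "i \<in> {1..q}" "j \<in> {1..q}" "i < j"
    then have "z i \<le> z j" "z i \<noteq> z j"
      using z[of i j] inj_onD[OF \<open>inj_on z {1..q}\<close>, of i j] by auto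
    then show "z i < z j" by simp
  qed
  then show ?thesis using strict_mono_on_same_image[OF y _ im assms(5)] by simp
qed

section \<open>Families of polynomials\<close>

lemma poly_eq_sum_coeff:
  fixes p :: "real poly"
  assumes "degree p \<le> N"
  shows "poly p x = (\<Sum>k\<le>N. coeff p k * x ^ k)"
  unfolding poly_altdef using assms
  by (intro sum.mono_neutral_left) (auto simp: coeff_eq_0)

lemma Ck_on_coeff_mult:
  assumes "open S" "\<And>k. Ck_on r S (\<lambda>x. coeff (p x) k)" "\<And>k. Ck_on r S (\<lambda>x. coeff (p' x) k)"
  shows "Ck_on r S (\<lambda>x. coeff (p x * p' x :: real poly) k)"
  unfolding coeff_mult using assms by (intro Ck_on_sum Ck_on_mult)

lemma Ck_on_coeff_root_poly:
  assumes S: "open S" and y: "\<And>i. i \<in> {1..q} \<Longrightarrow> Ck_on r S (\<lambda>x. y x i)"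
  shows "Ck_on r S (\<lambda>x. coeff (root_poly q m (y x)) k)"
proof -
  have lin: "Ck_on r S (\<lambda>x. coeff [:- y x i, 1:] k)" if "i \<in> {1..q}" for i k
  proof (cases k)
    case 0
    have "Ck_on r S (\<lambda>x. (- 1) * y x i)" using y[OF that] S by (intro Ck_on_mult Ck_on_const)
    then show ?thesis using 0 by simp
  qed (simp add: Ck_on_const[OF S])
  have pow: "Ck_on r S (\<lambda>x. coeff ([:- y x i, 1:] ^ l) k)" if "i \<in> {1..q}" for i l k
  proof (induction l arbitrary: k)
    case 0
    show ?case by (simp add: Ck_on_const[OF S])
  next
    case (Suc l)
    show ?case unfolding power_Suc by (intro Ck_on_coeff_mult S lin that Suc)
  qed
  have "Ck_on r S (\<lambda>x. coeff (\<Prod>i\<in>I. [:- y x i, 1:] ^ m i) k)" if "I \<subseteq> {1..q}" for I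
    using that
  proof (induction I arbitrary: k rule: infinite_finite_induct)
    case (insert i I)
    show ?case unfolding prod.insert[OF insert.hyps]
      by (intro Ck_on_coeff_mult S pow insert.IH) (use insert.prems in auto)
  qed (simp_all add: Ck_on_const[OF S])
  then show ?thesis by (simp add: root_poly_def)
qed

lemma continuous_on_coeff_root_poly:
  fixes y :: "'a::topological_space \<Rightarrow> nat \<Rightarrow> real"
  assumes y: "\<And>i. i \<in> {1..q} \<Longrightarrow> continuous_on S (\<lambda>x. y x i)"
  shows "continuous_on S (\<lambda>x. coeff (root_poly q m (y x)) k)"
proof -
  have lin: "continuous_on S (\<lambda>x. coeff [:- y x i, 1:] k)" if "i \<in> {1..q}" for i k
  proof (cases k)
    case 0
    then show ?thesis using y[OF that] by (simp add: continuous_on_minus)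
  qed simp
  have mult: "continuous_on S (\<lambda>x. coeff (p x * p' x) k)"
    if "\<And>k. continuous_on S (\<lambda>x. coeff (p x) k)" "\<And>k. continuous_on S (\<lambda>x. coeff (p' x) k)"
    for p p' :: "'a \<Rightarrow> real poly" and k
    unfolding coeff_mult using that by (intro continuous_on_sum continuous_on_mult)
  have pow: "continuous_on S (\<lambda>x. coeff ([:- y x i, 1:] ^ l) k)" if "i \<in> {1..q}" for i l k
  proof (induction l arbitrary: k)
    case (Suc l)
    show ?case unfolding power_Suc by (intro mult lin that Suc)
  qed simp
  have "continuous_on S (\<lambda>x. coeff (\<Prod>i\<in>I. [:- y x i, 1:] ^ m i) k)" if "I \<subseteq> {1..q}" for I
    using that
  proof (induction I arbitrary: k rule: infinite_finite_induct)
    case (insert i I)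
    show ?case unfolding prod.insert[OF insert.hyps]
      by (intro mult pow insert.IH) (use insert.prems in auto)
  qed simp_all
  then show ?thesis by (simp add: root_poly_def)
qed

lemma Ck_on_coeff_higher_pderiv:
  assumes "open S" "\<And>k. Ck_on r S (\<lambda>x. coeff (p x) k)"
  shows "Ck_on r S (\<lambda>x. coeff ((pderiv ^^ l) (p x) :: real poly) k)"
  unfolding coeff_higher_pderiv using assms by (intro Ck_on_mult Ck_on_const)

lemma Ck_on_poly:
  fixes p :: "'a::euclidean_space \<Rightarrow> real poly"
  assumes "open S" "\<And>k. Ck_on r S (\<lambda>x. coeff (p x) k)" "\<And>x. degree (p x) \<le> N" "Ck_on r S \<phi>"
  shows "Ck_on r S (\<lambda>x. poly (p x) (\<phi> x))"
proof -
  have "poly (p x) (\<phi> x) = (\<Sum>k\<le>N. coeff (p x) k * \<phi> x ^ k)" for x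
    using assms(3) by (rule poly_eq_sum_coeff)
  then show ?thesis using assms by (simp add: Ck_on_sum Ck_on_mult Ck_on_power)
qed

text \<open>Differentiability of a one-parameter family of polynomials, coefficient by coefficient; for families
  of bounded degree it implies the derivative of any evaluation.\<close>

definition has_coeff_derivative :: "(real \<Rightarrow> real poly) \<Rightarrow> real poly \<Rightarrow> real \<Rightarrow> bool" where
  "has_coeff_derivative p p' t \<longleftrightarrow>
     (\<forall>k. ((\<lambda>s. coeff (p s) k) has_field_derivative coeff p' k) (at t))"

lemma has_coeff_derivative_const: "has_coeff_derivative (\<lambda>s. p) 0 t"
  by (simp add: has_coeff_derivative_def)

lemma has_coeff_derivative_mult:
  assumes "has_coeff_derivative p p' t" "has_coeff_derivative g g' t"
  shows "has_coeff_derivative (\<lambda>s. p s * g s) (p' * g t + p t * g') t"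
  unfolding has_coeff_derivative_def
proof
  fix k
  have "((\<lambda>s. \<Sum>i\<le>k. coeff (p s) i * coeff (g s) (k - i)) has_field_derivative
      (\<Sum>i\<le>k. coeff p' i * coeff (g t) (k - i) + coeff g' (k - i) * coeff (p t) i)) (at t)"
    using assms unfolding has_coeff_derivative_def by (intro DERIV_sum DERIV_mult) auto
  also have "(\<Sum>i\<le>k. coeff p' i * coeff (g t) (k - i) + coeff g' (k - i) * coeff (p t) i)
      = coeff (p' * g t + p t * g') k"
    unfolding coeff_add coeff_mult sum.distrib by (simp only: mult.commute)
  finally show "((\<lambda>s. coeff (p s * g s) k) has_field_derivative coeff (p' * g t + p t * g') k) (at t)"
    unfolding coeff_mult .
qed

lemma has_coeff_derivative_linear_power:
  "has_coeff_derivative (\<lambda>s. [:- (c + s), 1:] ^ l)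
     (Polynomial.smult (- real l) ([:- (c + t), 1:] ^ (l - 1))) t"
proof (induction l)
  case 0
  show ?case using has_coeff_derivative_const[of 1] by simp
next
  case (Suc l)
  have lin: "has_coeff_derivative (\<lambda>s. [:- (c + s), 1:]) [:- 1:] t"
    unfolding has_coeff_derivative_def
  proof
    fix k show "((\<lambda>s. coeff [:- (c + s), 1:] k) has_field_derivative coeff [:- 1:] k) (at t)"
      by (cases k) (auto intro!: derivative_eq_intros simp: coeff_pCons split: nat.splits)
  qed
  have "[:- (c + t), 1:] * Polynomial.smult (- real l) ([:- (c + t), 1:] ^ (l - 1))
      = Polynomial.smult (- real l) ([:- (c + t), 1:] ^ l)"
    by (cases l) (simp_all del: mult_pCons_left)
  then have "[:- 1:] * [:- (c + t), 1:] ^ l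
      + [:- (c + t), 1:] * Polynomial.smult (- real l) ([:- (c + t), 1:] ^ (l - 1))
      = Polynomial.smult (- real (Suc l)) ([:- (c + t), 1:] ^ (Suc l - 1))"
    by (simp add: smult_add_left smult_diff_left)
  then show ?case using has_coeff_derivative_mult[OF lin Suc] by (simp only: power_Suc)
qed

lemma has_coeff_derivative_higher_pderiv:
  assumes "has_coeff_derivative p p' t"
  shows "has_coeff_derivative (\<lambda>s. (pderiv ^^ l) (p s)) ((pderiv ^^ l) p') t"
  using assms unfolding has_coeff_derivative_def coeff_higher_pderiv by (intro allI DERIV_cmult) auto

text \<open>The point of evaluation moves along with the polynomial, so the derivative has two parts; they
  are the source of the two terms in the partial derivatives of \<open>P^(k)(y i)\<close>.\<close>

lemma poly_has_derivative_of_coeff_derivative: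
  assumes p: "has_coeff_derivative p p' t" and N: "\<And>s. degree (p s) \<le> N" "degree p' \<le> N"
    and x: "(x has_field_derivative x') (at t)"
  shows "((\<lambda>s. poly (p s) (x s)) has_field_derivative
           poly p' (x t) + poly (pderiv (p t)) (x t) * x') (at t)"
proof -
  have eq: "poly g c = (\<Sum>k\<le>N. coeff g k * c ^ k)" if "degree g \<le> N" for g and c :: real
    using that by (rule poly_eq_sum_coeff)
  have "((\<lambda>s. \<Sum>k\<le>N. coeff (p s) k * x s ^ k) has_field_derivative
      (\<Sum>k\<le>N. coeff p' k * x t ^ k + coeff (p t) k * (real k * x t ^ (k - 1) * x'))) (at t)"
    using p x unfolding has_coeff_derivative_def
    by (intro DERIV_sum) (auto intro!: derivative_eq_intros)
  moreover have "((\<lambda>c. poly (p t) c) has_field_derivative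
      (\<Sum>k\<le>N. coeff (p t) k * (real k * x t ^ (k - 1)))) (at (x t))"
    unfolding eq[OF N(1)] by (intro DERIV_sum) (auto intro!: derivative_eq_intros)
  then have d: "(\<Sum>k\<le>N. coeff (p t) k * (real k * x t ^ (k - 1))) = poly (pderiv (p t)) (x t)"
    using poly_DERIV DERIV_unique by blast
  have "(\<Sum>k\<le>N. coeff p' k * x t ^ k + coeff (p t) k * (real k * x t ^ (k - 1) * x'))
      = poly p' (x t) + poly (pderiv (p t)) (x t) * x'"
    unfolding sum.distrib eq[OF N(2)] d[symmetric] by (simp add: sum_distrib_right mult.assoc)
  ultimately show ?thesis unfolding eq[OF N(1)] by simp
qed

section \<open>Smooth dependence of a simple root\<close>

text \<open>The product rule at a zero of the first factor: there the second factor has to be continuous only.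
  This allows the increment of an implicit function, which occurs on both sides of its
  equation, to be differentiated knowing no more than its continuity.\<close>

lemma has_derivative_increment_mult:
  fixes g h :: "'a::real_normed_vector \<Rightarrow> real"
  assumes g: "(g has_derivative g') (at a)" and h: "isCont h a"
  shows "((\<lambda>b. (g b - g a) * h b) has_derivative (\<lambda>v. g' v * h a)) (at a)"
  unfolding has_derivative_iff_norm
proof
  have bl: "bounded_linear g'" using g by (rule has_derivative_bounded_linear)
  then show "bounded_linear (\<lambda>v. g' v * h a)" by (rule bounded_linear_mult_const)
  obtain K where K: "\<And>v. norm (g' v) \<le> norm v * K" using bounded_linear.bounded[OF bl] by blast
  let ?r = "\<lambda>b. norm (g b - g a - g' (b - a)) / norm (b - a)"
  have r: "(?r \<longlongrightarrow> 0) (at a)"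
    using g unfolding has_derivative_iff_norm by simp
  have hb: "((\<lambda>b. norm (h b)) \<longlongrightarrow> norm (h a)) (at a)"
    using h unfolding isCont_def by (rule tendsto_norm)
  have "((\<lambda>b. norm (h b - h a)) \<longlongrightarrow> 0) (at a)"
    using tendsto_norm_zero[OF LIM_zero[OF h[unfolded isCont_def]]] .
  then have lim: "((\<lambda>b. ?r b * norm (h b) + K * norm (h b - h a)) \<longlongrightarrow> 0 * norm (h a) + K * 0) (at a)"
    by (intro tendsto_add tendsto_mult r hb tendsto_const)
  have le: "norm ((g b - g a) * h b - (g a - g a) * h a - g' (b - a) * h a) / norm (b - a)
      \<le> ?r b * norm (h b) + K * norm (h b - h a)" if "b \<noteq> a" for b
  proof -
    have pos: "norm (b - a) > 0" using that by simp
    have "(g b - g a) * h b - (g a - g a) * h a - g' (b - a) * h a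
        = (g b - g a - g' (b - a)) * h b + g' (b - a) * (h b - h a)"
      by (simp add: algebra_simps)
    then have "norm ((g b - g a) * h b - (g a - g a) * h a - g' (b - a) * h a)
        \<le> norm (g b - g a - g' (b - a)) * norm (h b) + norm (g' (b - a)) * norm (h b - h a)"
      by (metis norm_mult norm_triangle_ineq)
    also have "\<dots> \<le> norm (g b - g a - g' (b - a)) * norm (h b) + norm (b - a) * K * norm (h b - h a)"
      by (intro add_left_mono mult_right_mono K) simp
    also have "\<dots> = (?r b * norm (h b) + K * norm (h b - h a)) * norm (b - a)"
      using pos by (simp add: field_simps)
    finally show ?thesis using pos by (simp only: pos_divide_le_eq)
  qed
  show "((\<lambda>b. norm ((g b - g a) * h b - (g a - g a) * h a - g' (b - a) * h a) / norm (b - a)) \<longlongrightarrow> 0) (at a)"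
  proof (rule tendsto_sandwich[OF _ _ tendsto_const])
    show "((\<lambda>b. ?r b * norm (h b) + K * norm (h b - h a)) \<longlongrightarrow> 0) (at a)"
      using lim by simp
    show "\<forall>\<^sub>F b in at a. 0 \<le> norm ((g b - g a) * h b - (g a - g a) * h a - g' (b - a) * h a) / norm (b - a)"
      by (intro always_eventually allI) simp
    show "\<forall>\<^sub>F b in at a. norm ((g b - g a) * h b - (g a - g a) * h a - g' (b - a) * h a) / norm (b - a)
      \<le> ?r b * norm (h b) + K * norm (h b - h a)"
      using le by (auto simp: eventually_at_filter)
  qed
qed

text \<open>An implicit function theorem for polynomial equations. Near \<open>G\<close> the polynomial \<open>p a\<close> is strictly monotone
  on an interval around \<open>x0\<close> and changes sign there, so it has exactly one root \<open>\<phi> a\<close> in it, and \<open>\<phi>\<close> is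
  continuous because its graph is closed and its values stay in a compact interval. Subtracting the equations for \<open>a\<close> and \<open>b\<close> expresses
  \<open>\<phi> b - \<phi> a\<close> through increments of the coefficients, hence the derivative, and the formula
  for the derivative raises the class of \<open>\<phi>\<close> step by step.\<close>

lemma smooth_simple_root:
  fixes p :: "'a::euclidean_space \<Rightarrow> real poly"
  assumes S: "open S" "G \<in> S"
    and smooth: "\<And>r k. Ck_on r S (\<lambda>a. coeff (p a) k)" and N: "\<And>a. degree (p a) \<le> N"
    and root: "poly (p G) x0 = 0" and simple: "poly (pderiv (p G)) x0 \<noteq> 0"
  obtains W \<delta> \<phi> where "open W" "G \<in> W" "0 < \<delta>" "smooth_on W \<phi>"
    "\<And>a x. a \<in> W \<Longrightarrow> \<bar>x - x0\<bar> \<le> \<delta> \<Longrightarrow> poly (p a) x = 0 \<Longrightarrow> x = \<phi> a"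
proof -
  define F where "F a x = poly (p a) x" for a x
  define F' where "F' a x = poly (pderiv (p a)) x" for a x
  \<comment> \<open>The sign \<open>\<sigma>\<close> reduces to the case of an increasing polynomial.\<close>
  define \<sigma> where "\<sigma> = sgn (F' G x0)"
  have Feq: "F a x = (\<Sum>k\<le>N. coeff (p a) k * x ^ k)" for a x
    unfolding F_def by (rule poly_eq_sum_coeff[OF N])
  have N': "degree (pderiv (p a)) \<le> N" for a
    using N[of a] by (simp add: degree_pderiv)
  have F'eq: "F' a x = (\<Sum>k\<le>N. coeff (pderiv (p a)) k * x ^ k)" for a x
    unfolding F'_def by (rule poly_eq_sum_coeff[OF N'])
  have coeff_cont: "continuous_on S (\<lambda>a. coeff (p a) k)" for k
    using smooth by (rule Ck_on_continuous)
  have smooth': "Ck_on r S (\<lambda>a. coeff (pderiv (p a)) k)" for r k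
    using Ck_on_coeff_higher_pderiv[OF S(1) smooth, of r 1 k] by simp
  have coeff_cont': "continuous_on S (\<lambda>a. coeff (pderiv (p a)) k)" for k
    using smooth' by (rule Ck_on_continuous)
  have contF: "continuous_on (S \<times> UNIV) (\<lambda>z. F (fst z) (snd z))"
    unfolding Feq by (intro continuous_intros continuous_on_compose2[OF coeff_cont]) auto
  have contF': "continuous_on (S \<times> UNIV) (\<lambda>z. F' (fst z) (snd z))"
    unfolding F'eq by (intro continuous_intros continuous_on_compose2[OF coeff_cont']) auto
  let ?O = "{z \<in> S \<times> UNIV. \<sigma> * F' (fst z) (snd z) > 0}"
  have "open ?O"
  proof -
    have "open ((S \<times> UNIV) \<inter> (\<lambda>z. \<sigma> * F' (fst z) (snd z)) -` {0<..})"
      by (intro continuous_open_preimage continuous_intros contF' open_Times S open_UNIV open_greaterThan)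
    also have "(S \<times> UNIV) \<inter> (\<lambda>z. \<sigma> * F' (fst z) (snd z)) -` {0<..} = ?O" by auto
    finally show ?thesis .
  qed
  moreover have "(G, x0) \<in> ?O"
    using S simple by (auto simp: \<sigma>_def F'_def sgn_if)
  ultimately obtain A B where AB: "open A" "open B" "(G, x0) \<in> A \<times> B" "A \<times> B \<subseteq> ?O"
    by (rule open_prod_elim)
  then obtain \<delta> where \<delta>: "0 < \<delta>" "cball x0 \<delta> \<subseteq> B"
    using open_contains_cball[of B] by auto
  let ?I = "{x0 - \<delta>..x0 + \<delta>}"
  have der_pos: "\<sigma> * F' a x > 0" if "a \<in> A" "x \<in> ?I" for a x
  proof -
    have "x \<in> B" using that(2) \<delta>(2) by (auto simp: cball_def dist_real_def subset_iff abs_le_iff)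
    then show ?thesis using AB(4) that(1) by auto
  qed
  have AS: "A \<subseteq> S" using AB(3,4) by auto
  have inc: "\<sigma> * F a x < \<sigma> * F a x'" if "a \<in> A" "x \<in> ?I" "x' \<in> ?I" "x < x'" for a x x'
  proof (rule DERIV_pos_imp_increasing[OF that(4)])
    fix u assume u: "x \<le> u" "u \<le> x'"
    have "((\<lambda>x. \<sigma> * F a x) has_real_derivative \<sigma> * F' a u) (at u)"
      unfolding F_def F'_def by (intro DERIV_cmult poly_DERIV)
    then show "\<exists>d. ((\<lambda>x. \<sigma> * F a x) has_real_derivative d) (at u) \<and> 0 < d"
      using der_pos[of a u] that u by auto
  qed
  have uniq: "x = x'" if "a \<in> A" "x \<in> ?I" "x' \<in> ?I" "F a x = 0" "F a x' = 0" for a x x'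
    using inc[of a x x'] inc[of a x' x] that by (cases x x' rule: linorder_cases) auto
  define W where "W = {a \<in> A. \<sigma> * F a (x0 - \<delta>) < 0 \<and> 0 < \<sigma> * F a (x0 + \<delta>)}"
  have contA: "continuous_on A (\<lambda>a. F a x)" for x
    unfolding Feq by (intro continuous_intros continuous_on_subset[OF coeff_cont AS])
  have "open W"
  proof -
    have "open ((A \<inter> (\<lambda>a. \<sigma> * F a (x0 - \<delta>)) -` {..<0}) \<inter> (A \<inter> (\<lambda>a. \<sigma> * F a (x0 + \<delta>)) -` {0<..}))"
      by (intro open_Int continuous_open_preimage continuous_intros contA AB open_greaterThan open_lessThan)
    also have "(A \<inter> (\<lambda>a. \<sigma> * F a (x0 - \<delta>)) -` {..<0}) \<inter> (A \<inter> (\<lambda>a. \<sigma> * F a (x0 + \<delta>)) -` {0<..}) = W"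
      unfolding W_def by auto
    finally show ?thesis .
  qed
  have "G \<in> W"
    using inc[of G "x0 - \<delta>" x0] inc[of G x0 "x0 + \<delta>"] root AB(3) \<delta>(1)
    unfolding W_def F_def by auto
  have "\<exists>x\<in>?I. F a x = 0" if "a \<in> W" for a
  proof -
    have "\<exists>x. x0 - \<delta> \<le> x \<and> x \<le> x0 + \<delta> \<and> \<sigma> * F a x = 0"
      using that \<delta>(1) unfolding W_def F_def by (intro IVT') (auto intro!: continuous_intros)
    moreover have "\<sigma> \<noteq> 0" using simple by (auto simp: \<sigma>_def F'_def sgn_if)
    ultimately show ?thesis by auto
  qed
  then obtain \<phi> where \<phi>: "\<And>a. a \<in> W \<Longrightarrow> \<phi> a \<in> ?I" "\<And>a. a \<in> W \<Longrightarrow> F a (\<phi> a) = 0"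
    by metis
  have WA: "W \<subseteq> A" unfolding W_def by auto
  have WS: "W \<subseteq> S" using WA AS by auto
  have F'0: "F' a (\<phi> a) \<noteq> 0" if "a \<in> W" for a
    using der_pos[of a "\<phi> a"] \<phi>(1)[OF that] WA that by auto
  have cont\<phi>: "continuous_on W \<phi>"
  proof (rule continuous_closed_graph_eq[of ?I \<phi> W, THEN iffD2])
    have graph: "(\<lambda>a. (a, \<phi> a)) ` W = (W \<times> ?I) \<inter> (\<lambda>z. F (fst z) (snd z)) -` {0}"
    proof (intro equalityI subsetI)
      fix z assume "z \<in> (\<lambda>a. (a, \<phi> a)) ` W"
      then obtain a where "z = (a, \<phi> a)" "a \<in> W" by blast
      then show "z \<in> (W \<times> ?I) \<inter> (\<lambda>z. F (fst z) (snd z)) -` {0}"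
        using \<phi>[of a] by simp
    next
      fix z assume "z \<in> (W \<times> ?I) \<inter> (\<lambda>z. F (fst z) (snd z)) -` {0}"
      then obtain a x where z: "z = (a, x)" "a \<in> W" "x \<in> ?I" "F a x = 0" by auto
      then have "x = \<phi> a" using \<phi>[of a] WA by (intro uniq[of a x "\<phi> a"]) blast+
      then show "z \<in> (\<lambda>a. (a, \<phi> a)) ` W" using z by blast
    qed
    show "closedin (top_of_set (W \<times> ?I)) ((\<lambda>a. (a, \<phi> a)) ` W)"
      unfolding graph using WS
      by (intro continuous_closedin_preimage continuous_on_subset[OF contF]) auto
  qed (use \<phi>(1) in auto)
  define D where "D a v = (\<Sum>k\<le>N. (- 1) * (frechet_derivative (\<lambda>a. coeff (p a) k) (at a) v
      * (\<phi> a ^ k * inverse (F' a (\<phi> a)))))" for a v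
  have der: "(\<phi> has_derivative D a) (at a)" if a: "a \<in> W" for a
  proof -
    \<comment> \<open>\<open>Q\<close> is the difference quotient of \<open>p a\<close> at its root \<open>\<phi> a\<close>, and it has no zero on the interval.\<close>
    define Q where "Q = synthetic_div (p a) (\<phi> a)"
    have pQ: "p a = [:- \<phi> a, 1:] * Q"
      using synthetic_div_correct'[of "\<phi> a" "p a"] \<phi>(2)[OF a] by (simp add: F_def Q_def)
    have FQ: "F a x = (x - \<phi> a) * poly Q x" for x
      unfolding F_def by (subst pQ) (simp add: algebra_simps)
    have F'Q: "F' a (\<phi> a) = poly Q (\<phi> a)"
      unfolding F'_def by (subst pQ) (simp add: pderiv_mult pderiv_pCons del: mult_pCons_left)
    have Q0: "poly Q x \<noteq> 0" if "x \<in> ?I" for x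
    proof
      assume "poly Q x = 0"
      then have "x = \<phi> a" using uniq[of a x "\<phi> a"] that \<phi>[OF a] WA a FQ by auto
      with \<open>poly Q x = 0\<close> F'0[OF a] F'Q show False by simp
    qed
    have eq: "\<phi> a - (\<Sum>k\<le>N. (coeff (p b) k - coeff (p a) k) * (\<phi> b ^ k * inverse (poly Q (\<phi> b)))) = \<phi> b"
      if b: "b \<in> W" for b
    proof -
      have "(\<Sum>k\<le>N. (coeff (p b) k - coeff (p a) k) * \<phi> b ^ k) = F b (\<phi> b) - F a (\<phi> b)"
        unfolding Feq by (simp add: algebra_simps sum_subtractf)
      also have "\<dots> = - ((\<phi> b - \<phi> a) * poly Q (\<phi> b))"
        using \<phi>(2)[OF b] FQ by simp
      finally have "(\<Sum>k\<le>N. (coeff (p b) k - coeff (p a) k) * \<phi> b ^ k) * inverse (poly Q (\<phi> b)) = \<phi> a - \<phi> b"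
        using Q0[OF \<phi>(1)[OF b]] by (simp add: field_simps)
      then show ?thesis by (simp add: sum_distrib_right mult.assoc)
    qed
    have "isCont \<phi> a" using cont\<phi> \<open>open W\<close> a continuous_on_eq_continuous_at by blast
    then have "isCont (\<lambda>b. \<phi> b ^ k * inverse (poly Q (\<phi> b))) a" for k
      using Q0[OF \<phi>(1)[OF a]] by (intro continuous_intros) auto
    moreover have "((\<lambda>a. coeff (p a) k) has_derivative frechet_derivative (\<lambda>a. coeff (p a) k) (at a)) (at a)" for k
      using smooth[of "Suc 0" k] a WS by (auto simp: frechet_derivative_works[symmetric])
    ultimately have "((\<lambda>b. \<phi> a - (\<Sum>k\<le>N. (coeff (p b) k - coeff (p a) k) * (\<phi> b ^ k * inverse (poly Q (\<phi> b)))))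
        has_derivative (\<lambda>v. 0 - (\<Sum>k\<le>N. frechet_derivative (\<lambda>a. coeff (p a) k) (at a) v
          * (\<phi> a ^ k * inverse (poly Q (\<phi> a)))))) (at a)"
      by (intro has_derivative_diff has_derivative_const has_derivative_sum has_derivative_increment_mult)
    then have "(\<phi> has_derivative (\<lambda>v. 0 - (\<Sum>k\<le>N. frechet_derivative (\<lambda>a. coeff (p a) k) (at a) v
          * (\<phi> a ^ k * inverse (poly Q (\<phi> a)))))) (at a)"
      by (rule has_derivative_transform_within_open[OF _ \<open>open W\<close> a eq])
    also have "(\<lambda>v. 0 - (\<Sum>k\<le>N. frechet_derivative (\<lambda>a. coeff (p a) k) (at a) v
          * (\<phi> a ^ k * inverse (poly Q (\<phi> a))))) = D a"
      unfolding D_def F'Q by (simp add: sum_negf fun_eq_iff)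
    finally show ?thesis .
  qed
  have "Ck_on r W \<phi>" for r
  proof (induction r)
    case 0
    show ?case using cont\<phi> by simp
  next
    case (Suc r)
    have F'r: "Ck_on r W (\<lambda>a. F' a (\<phi> a))"
      unfolding F'_def using Ck_on_subset[OF smooth' WS] N' Suc \<open>open W\<close> by (intro Ck_on_poly)
    have dr: "Ck_on r W (\<lambda>a. frechet_derivative (\<lambda>a. coeff (p a) k) (at a) v)" for k v
      using smooth[of "Suc r" k] by (intro Ck_on_subset[OF _ WS]) simp
    show ?case
    proof (rule Ck_on_SucI[OF \<open>open W\<close> der])
      show "Ck_on r W (\<lambda>a. D a v)" for v
        unfolding D_def using F'0
        by (intro Ck_on_sum Ck_on_mult Ck_on_const Ck_on_power Ck_on_inverse \<open>open W\<close> dr Suc F'r)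
    qed
  qed
  then have "smooth_on W \<phi>" using \<open>open W\<close> by (simp add: smooth_on_def)
  moreover have "x = \<phi> a" if "a \<in> W" "\<bar>x - x0\<bar> \<le> \<delta>" "poly (p a) x = 0" for a x
    using uniq[of a x "\<phi> a"] \<phi>[OF that(1)] that WA by (auto simp: F_def abs_le_iff)
  ultimately show ?thesis using that \<open>open W\<close> \<open>G \<in> W\<close> \<delta>(1) by blast
qed

section \<open>Continuity of the roots on the stratum\<close>

text \<open>For \<open>\<bar>x\<bar> > 1\<close> the lower terms are at most \<open>n * norm a * \<bar>x\<bar>^(n-1)\<close> in total, and they have to
  balance \<open>x^n\<close>. The bound confines the root vectors near a point to a compact box.\<close>

lemma monic_poly_roots_bounded:
  fixes a :: "real ^ 'n::finite"
  assumes "poly (monic_poly e a) x = 0"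
  shows "\<bar>x\<bar> \<le> 1 + real CARD('n) * norm a"
proof (cases "\<bar>x\<bar> \<le> 1")
  case True
  then show ?thesis by (simp add: add_increasing2)
next
  case False
  obtain l where n: "CARD('n) = Suc l" using gr0_implies_Suc[OF zero_less_card_finite] by blast
  have "0 = (\<Sum>k\<le>Suc l. coeff (monic_poly e a) k * x ^ k)"
    using assms monic_monic_poly(1)[of e a] poly_eq_sum_coeff[of "monic_poly e a" "Suc l" x] n by simp
  also have "\<dots> = (\<Sum>k\<le>l. coeff (monic_poly e a) k * x ^ k) + x ^ Suc l"
    by (subst sum.atMost_Suc) (simp add: coeff_monic_poly n)
  finally have "x ^ Suc l = - (\<Sum>k\<le>l. coeff (monic_poly e a) k * x ^ k)" by linarith
  then have "\<bar>x\<bar> ^ Suc l = \<bar>\<Sum>k\<le>l. coeff (monic_poly e a) k * x ^ k\<bar>"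
    unfolding power_abs[symmetric] by (simp only: abs_minus_cancel)
  also have "\<dots> \<le> (\<Sum>k\<le>l. \<bar>coeff (monic_poly e a) k * x ^ k\<bar>)" by (rule sum_abs)
  also have "\<dots> \<le> (\<Sum>k\<le>l. norm a * \<bar>x\<bar> ^ l)"
  proof (rule sum_mono)
    fix k assume k: "k \<in> {..l}"
    have "\<bar>coeff (monic_poly e a) k\<bar> \<le> norm a"
      using k n component_le_norm_cart[of a] by (simp add: coeff_monic_poly)
    moreover have "\<bar>x\<bar> ^ k \<le> \<bar>x\<bar> ^ l" using False k by (intro power_increasing) auto
    ultimately show "\<bar>coeff (monic_poly e a) k * x ^ k\<bar> \<le> norm a * \<bar>x\<bar> ^ l"
      unfolding abs_mult power_abs by (intro mult_mono) auto
  qed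
  also have "\<dots> = (real CARD('n) * norm a) * \<bar>x\<bar> ^ l" using n by (simp add: algebra_simps)
  finally have "\<bar>x\<bar> * \<bar>x\<bar> ^ l \<le> (real CARD('n) * norm a) * \<bar>x\<bar> ^ l"
    unfolding power_Suc .
  moreover have "0 < \<bar>x\<bar> ^ l" using False by simp
  ultimately have "\<bar>x\<bar> \<le> real CARD('n) * norm a" by (rule mult_right_le_imp_le)
  then show ?thesis by simp
qed

text \<open>The weakly sorted root vectors in a large box that stay \<open>\<epsilon>\<close>-away from \<open>y\<close> form a compact
  set, so their coefficient vectors form a closed set. By uniqueness of sorted roots \<open>G\<close> is not in it,
  and its complement within a ball is the required neighbourhood. Weak monotonicity is
  essential: the strict order of roots is not a closed condition.\<close>

lemma roots_continuous_on_stratum: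
  fixes e :: "nat \<Rightarrow> 'n::finite" and y :: "nat \<Rightarrow> real"
  assumes e: "bij_betw e {1..CARD('n)} UNIV"
    and m: "\<forall>i\<in>{1..q}. 0 < m i" "(\<Sum>i=1..q. m i) = CARD('n)"
    and y: "strict_mono_on {1..q} y" "monic_poly e G = root_poly q m y" and "0 < \<epsilon>"
  obtains U where "open U" "G \<in> U"
    "\<And>a z i. a \<in> U \<Longrightarrow> strict_mono_on {1..q} z \<Longrightarrow> monic_poly e a = root_poly q m z \<Longrightarrow>
       i \<in> {1..q} \<Longrightarrow> \<bar>z i - y i\<bar> < \<epsilon>"
proof -
  define R where "R = 1 + real CARD('n) * (norm G + 1)"
  define \<Phi> where "\<Phi> z = coeff_vec e (root_poly q m z)" for z
  have \<Phi>: "monic_poly e (\<Phi> z) = root_poly q m z" for z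
    unfolding \<Phi>_def using monic_root_poly[of q m z] m by (intro monic_poly_coeff_vec e) simp_all
  define C where "C = (\<Inter>i\<in>{1..q}. \<Inter>j\<in>{i..q}. {z :: nat \<Rightarrow> real. z i \<le> z j})"
  define E where "E = (\<Union>i\<in>{1..q}. {z :: nat \<Rightarrow> real. \<epsilon> \<le> \<bar>z i - y i\<bar>})"
  \<comment> \<open>The root vectors are functions on all of \<open>nat\<close>, so that compactness comes from the product topology.\<close>
  define K where "K = (\<Pi>\<^sub>E (i::nat)\<in>UNIV. {-R..R})"
  have "compact K"
  proof -
    have "compactin (product_topology (\<lambda>i::nat. euclidean) UNIV) K"
      unfolding K_def by (simp add: compactin_PiE)
    then show ?thesis by (simp add: euclidean_product_topology)
  qed
  moreover have "closed C" unfolding C_def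
    by (intro closed_INT ballI closed_Collect_le continuous_on_product_coordinates)
  moreover have "closed E" unfolding E_def
    by (intro closed_UN ballI closed_Collect_le continuous_intros continuous_on_product_coordinates) auto
  ultimately have "compact (K \<inter> C \<inter> E)" by (intro compact_Int_closed)
  moreover have "continuous_on UNIV \<Phi>"
    unfolding \<Phi>_def coeff_vec_def
    by (intro continuous_on_vec_lambda continuous_on_coeff_root_poly continuous_on_product_coordinates)
  ultimately have "compact (\<Phi> ` (K \<inter> C \<inter> E))"
    by (meson compact_continuous_image continuous_on_subset subset_UNIV)
  then have "closed (\<Phi> ` (K \<inter> C \<inter> E))" by (rule compact_imp_closed)
  then have "open (ball G 1 - \<Phi> ` (K \<inter> C \<inter> E))" by (intro open_Diff open_ball)
  moreover have "G \<notin> \<Phi> ` (K \<inter> C \<inter> E)"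
  proof
    assume "G \<in> \<Phi> ` (K \<inter> C \<inter> E)"
    then obtain z where z: "G = \<Phi> z" "z \<in> C" "z \<in> E" by blast
    have "root_poly q m z = root_poly q m y" using \<Phi>[of z] y(2) z(1) by simp
    then have "z i = y i" if "i \<in> {1..q}" for i
      using z(2) by (intro weakly_sorted_roots_unique[OF m(1) y(1) _ _ that]) (auto simp: C_def)
    then show False using z(3) \<open>0 < \<epsilon>\<close> by (auto simp: E_def)
  qed
  moreover have "\<bar>z i - y i\<bar> < \<epsilon>"
    if a: "a \<in> ball G 1 - \<Phi> ` (K \<inter> C \<inter> E)" and z: "strict_mono_on {1..q} z"
      "monic_poly e a = root_poly q m z" and i: "i \<in> {1..q}" for a z i
  proof -
    \<comment> \<open>Only the values on \<open>{1..q}\<close> matter; the others are set to 0 to stay inside the box.\<close>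
    define z' where "z' i = (if i \<in> {1..q} then z i else 0)" for i
    have "root_poly q m z' = root_poly q m z"
      unfolding root_poly_def z'_def by (intro prod.cong) auto
    then have "\<Phi> z' = a"
      unfolding \<Phi>_def using z(2) coeff_vec_monic_poly[OF e] by metis
    moreover have "z' \<in> C"
      unfolding C_def z'_def using strict_mono_on_leD[OF z(1)] by auto
    moreover have "z' \<in> K"
    proof -
      have "norm a \<le> norm G + 1"
        using a norm_triangle_sub[of a G] by (auto simp: dist_norm norm_minus_commute)
      then have "1 + real CARD('n) * norm a \<le> R"
        unfolding R_def by (intro add_left_mono mult_left_mono) auto
      moreover have "\<bar>z j\<bar> \<le> 1 + real CARD('n) * norm a" if "j \<in> {1..q}" for j
        using poly_root_poly_eq_0_iff[OF m(1), of z "z j"] z(2) that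
        by (intro monic_poly_roots_bounded[where e = e]) auto
      moreover have "0 \<le> R" unfolding R_def by simp
      ultimately show ?thesis by (fastforce simp: K_def z'_def abs_le_iff)
    qed
    ultimately have "z' \<notin> E" using a by blast
    then show ?thesis using i by (auto simp: E_def z'_def not_le)
  qed
  ultimately show ?thesis using that[of "ball G 1 - \<Phi> ` (K \<inter> C \<inter> E)"] by auto
qed

section \<open>The discriminant hypersurfaces\<close>

lemma degree_higher_pderiv_le: "degree ((pderiv ^^ l) p) \<le> degree (p :: real poly)"
  by (simp add: degree_higher_pderiv)

lemma Ck_on_coeff_monic_poly:
  fixes e :: "nat \<Rightarrow> 'n::finite"
  assumes "open S"
  shows "Ck_on r S (\<lambda>a. coeff (monic_poly e a) k)"
  unfolding coeff_monic_poly
  by (cases "k < CARD('n)"; cases "k = CARD('n)")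
    (simp_all add: Ck_on_bounded_linear[OF assms] Ck_on_const[OF assms] bounded_linear_vec_nth)

lemma Ck_on_coeff_vec:
  fixes e :: "nat \<Rightarrow> 'n::finite" and p :: "'a::euclidean_space \<Rightarrow> real poly"
  assumes "open S" "\<And>k. Ck_on r S (\<lambda>x. coeff (p x) k)"
  shows "Ck_on r S (\<lambda>x. coeff_vec e (p x))"
proof -
  have "coeff_vec e (p x)
      = (\<Sum>b\<in>UNIV. coeff (p x) (CARD('n) - inv_into {1..CARD('n)} e b) *\<^sub>R axis b 1)" for x
    using basis_expansion[of "coeff_vec e (p x)"] by (simp add: scalar_mult_eq_scaleR coeff_vec_def)
  then show ?thesis using assms by (simp add: Ck_on_sum Ck_on_scaleR Ck_on_const)
qed

text \<open>Moving one root while fixing the others gives the coordinate curves of the stratum. They provide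
  enough tangent vectors for all that follows.\<close>

lemma stratum_root_curve:
  fixes e :: "nat \<Rightarrow> 'n::finite" and z :: "nat \<Rightarrow> real"
  assumes e: "bij_betw e {1..CARD('n)} UNIV"
    and m: "\<forall>i\<in>{1..q}. 0 < m i" "(\<Sum>i=1..q. m i) = CARD('n)"
    and z: "strict_mono_on {1..q} z" "monic_poly e a = root_poly q m z"
    and U: "open U" "a \<in> U"
  obtains \<gamma> \<epsilon> where "0 < \<epsilon>" "smooth_on {-\<epsilon><..<\<epsilon>} \<gamma>" "\<gamma> ` {-\<epsilon><..<\<epsilon>} \<subseteq> stratum e q m \<inter> U"
    "\<gamma> 0 = a"
    "\<And>t. t \<in> {-\<epsilon><..<\<epsilon>} \<Longrightarrow> strict_mono_on {1..q} (z(j := z j + t))"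
    "\<And>t. monic_poly e (\<gamma> t) = root_poly q m (z(j := z j + t))"
proof -
  define \<gamma> where "\<gamma> t = coeff_vec e (root_poly q m (z(j := z j + t)))" for t :: real
  have \<gamma>: "monic_poly e (\<gamma> t) = root_poly q m (z(j := z j + t))" for t
    unfolding \<gamma>_def using monic_root_poly m by (intro monic_poly_coeff_vec e) (metis, metis)
  have \<gamma>0: "\<gamma> 0 = a"
    unfolding \<gamma>_def using coeff_vec_monic_poly[OF e, of a] z(2) by simp
  have coord: "Ck_on r S (\<lambda>t. (z(j := z j + t)) i)" if "open S" for r S i
  proof (cases "i = j")
    case True
    have "Ck_on r S (\<lambda>t. z j + t)"
      using that by (intro Ck_on_add Ck_on_const Ck_on_bounded_linear[OF _ bounded_linear_ident])
    then show ?thesis using True by simp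
  qed (simp add: Ck_on_const[OF that])
  have Ck: "Ck_on r S \<gamma>" if "open S" for r S
    unfolding \<gamma>_def using that by (intro Ck_on_coeff_vec Ck_on_coeff_root_poly coord)
  have "continuous_on UNIV \<gamma>" using Ck[OF open_UNIV] by (rule Ck_on_continuous)
  then have "(\<gamma> \<longlongrightarrow> a) (nhds 0)"
    using \<gamma>0 by (metis UNIV_I continuous_on_eq_continuous_at isCont_def open_UNIV tendsto_at_iff_tendsto_nhds)
  then have evU: "\<forall>\<^sub>F t in nhds 0. \<gamma> t \<in> U"
    using U topological_tendstoD by blast
  have "\<forall>\<^sub>F t in nhds 0. (z(j := z j + t)) i < (z(j := z j + t)) i'"
    if "i \<in> {1..q}" "i' \<in> {i<..q}" for i i'
  proof -
    have "((\<lambda>t. (z(j := z j + t)) l) \<longlongrightarrow> (z(j := z j + 0)) l) (nhds 0)" for l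
      using Ck_on_continuous[OF coord[OF open_UNIV], of l]
      by (metis UNIV_I continuous_on_eq_continuous_at isCont_def open_UNIV tendsto_at_iff_tendsto_nhds)
    then have "((\<lambda>t. (z(j := z j + t)) i' - (z(j := z j + t)) i) \<longlongrightarrow>
        (z(j := z j + 0)) i' - (z(j := z j + 0)) i) (nhds 0)"
      by (intro tendsto_diff)
    moreover have "0 < (z(j := z j + 0)) i' - (z(j := z j + 0)) i"
      using z(1) that by (auto simp: strict_mono_on_def)
    ultimately have "\<forall>\<^sub>F t in nhds 0. 0 < (z(j := z j + t)) i' - (z(j := z j + t)) i"
      by (rule order_tendstoD(1))
    then show ?thesis by (rule eventually_mono) linarith
  qed
  then have evmono: "\<forall>\<^sub>F t in nhds 0. \<forall>i\<in>{1..q}. \<forall>i'\<in>{i<..q}. (z(j := z j + t)) i < (z(j := z j + t)) i'"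
    by (intro eventually_ball_finite ballI) auto
  from eventually_conj[OF evU evmono] obtain \<epsilon> where \<epsilon>: "0 < \<epsilon>"
    "\<And>t. dist t 0 < \<epsilon> \<Longrightarrow> \<gamma> t \<in> U \<and>
        (\<forall>i\<in>{1..q}. \<forall>i'\<in>{i<..q}. (z(j := z j + t)) i < (z(j := z j + t)) i')"
    unfolding eventually_nhds_metric by blast
  have mono: "strict_mono_on {1..q} (z(j := z j + t))" if "t \<in> {-\<epsilon><..<\<epsilon>}" for t
  proof (rule strict_mono_onI)
    fix i i' assume "i \<in> {1..q}" "i' \<in> {1..q}" "i < i'"
    moreover from this have "i' \<in> {i<..q}" by simp
    moreover have "dist t 0 < \<epsilon>" using that by (simp add: dist_real_def abs_less_iff)
    ultimately show "(z(j := z j + t)) i < (z(j := z j + t)) i'" using \<epsilon>(2) by blast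
  qed
  have "\<gamma> t \<in> stratum e q m \<inter> U" if "t \<in> {-\<epsilon><..<\<epsilon>}" for t
    using \<epsilon>(2)[of t] that mono[OF that] \<gamma>[of t] stratum_iff_root_poly[OF m, of "\<gamma> t" e]
    by (auto simp: dist_real_def)
  then have "\<gamma> ` {-\<epsilon><..<\<epsilon>} \<subseteq> stratum e q m \<inter> U" by blast
  moreover have "smooth_on {-\<epsilon><..<\<epsilon>} \<gamma>" using Ck by (simp add: smooth_on_def)
  ultimately show ?thesis using that \<epsilon>(1) \<gamma>0 mono \<gamma> by blast
qed

lemma has_coeff_derivative_root_poly:
  assumes j: "j \<in> {1..q}"
  shows "has_coeff_derivative (\<lambda>t. root_poly q m (z(j := z j + t)))
    (Polynomial.smult (- real (m j)) (cofactor_poly q m z j)) 0"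
proof -
  let ?R = "\<Prod>i\<in>{1..q} - {j}. [:- z i, 1:] ^ m i"
  have "root_poly q m (z(j := z j + t)) = [:- (z j + t), 1:] ^ m j * ?R" for t
  proof -
    have "root_poly q m (z(j := z j + t))
        = [:- (z j + t), 1:] ^ m j * (\<Prod>i\<in>{1..q} - {j}. [:- (z(j := z j + t)) i, 1:] ^ m i)"
      unfolding root_poly_def using j by (subst prod.remove[of _ j]) simp_all
    also have "(\<Prod>i\<in>{1..q} - {j}. [:- (z(j := z j + t)) i, 1:] ^ m i) = ?R"
      by (intro prod.cong) auto
    finally show ?thesis .
  qed
  moreover have "has_coeff_derivative (\<lambda>t. [:- (z j + t), 1:] ^ m j * ?R)
      (Polynomial.smult (- real (m j)) ([:- (z j + 0), 1:] ^ (m j - 1)) * ?R + [:- (z j + 0), 1:] ^ m j * 0) 0"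
    by (intro has_coeff_derivative_mult has_coeff_derivative_linear_power has_coeff_derivative_const)
  moreover have "Polynomial.smult (- real (m j)) ([:- (z j + 0), 1:] ^ (m j - 1)) * ?R + [:- (z j + 0), 1:] ^ m j * 0
      = Polynomial.smult (- real (m j)) (cofactor_poly q m z j)"
    unfolding cofactor_poly_def by (simp only: mult_smult_left mult_zero_right add_0_right)
  ultimately show ?thesis by simp
qed

text \<open>Along the curve that moves the root \<open>z j\<close>, the value \<open>f i\<close> is an explicit polynomial evaluated at an
  explicit point; comparing its derivative with the chain rule gives the differential of \<open>f i\<close>.\<close>

lemma root_equation_differential:
  fixes e :: "nat \<Rightarrow> 'n::finite" and z :: "nat \<Rightarrow> real"
  assumes e: "bij_betw e {1..CARD('n)} UNIV"
    and m: "\<forall>i\<in>{1..q}. 0 < m i" "(\<Sum>i=1..q. m i) = CARD('n)"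
    and z: "strict_mono_on {1..q} z" "monic_poly e a = root_poly q m z"
    and U: "open U" "a \<in> U" and j: "j \<in> {1..q}"
    and f: "\<And>i. i \<in> {1..q} \<Longrightarrow> f i differentiable (at a)"
    and feq: "\<And>b u i. b \<in> U \<Longrightarrow> strict_mono_on {1..q} u \<Longrightarrow> monic_poly e b = root_poly q m u \<Longrightarrow>
      i \<in> {1..q} \<Longrightarrow> f i b = poly ((pderiv ^^ k) (root_poly q m u)) (u i)"
  shows "\<exists>v\<in>tangent_space (stratum e q m \<inter> U) a. \<forall>i\<in>{1..q}. frechet_derivative (f i) (at a) v =
    (if i = j then poly ((pderiv ^^ Suc k) (root_poly q m z)) (z i) else 0)
      - real (m j) * poly ((pderiv ^^ k) (cofactor_poly q m z j)) (z i)"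
proof -
  obtain \<gamma> \<epsilon> where \<epsilon>: "0 < \<epsilon>" and smooth: "smooth_on {-\<epsilon><..<\<epsilon>} \<gamma>"
    and \<gamma>T: "\<gamma> ` {-\<epsilon><..<\<epsilon>} \<subseteq> stratum e q m \<inter> U" and \<gamma>0: "\<gamma> 0 = a"
    and mono: "\<And>t. t \<in> {-\<epsilon><..<\<epsilon>} \<Longrightarrow> strict_mono_on {1..q} (z(j := z j + t))"
    and \<gamma>: "\<And>t. monic_poly e (\<gamma> t) = root_poly q m (z(j := z j + t))"
    by (rule stratum_root_curve[OF e m z U, of j]) blast
  have "Ck_on (Suc 0) {-\<epsilon><..<\<epsilon>} \<gamma>" using smooth unfolding smooth_on_def by blast
  then have "\<gamma> differentiable (at 0)" using \<epsilon> by simp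
  then obtain v where v: "(\<gamma> has_vector_derivative v) (at 0)"
    using vector_derivative_works by blast
  have "v \<in> tangent_space (stratum e q m \<inter> U) a"
    unfolding tangent_space_def using \<epsilon> smooth \<gamma>T \<gamma>0 v by blast
  moreover have "frechet_derivative (f i) (at a) v =
      (if i = j then poly ((pderiv ^^ Suc k) (root_poly q m z)) (z i) else 0)
        - real (m j) * poly ((pderiv ^^ k) (cofactor_poly q m z j)) (z i)" if i: "i \<in> {1..q}" for i
  proof -
    let ?P = "\<lambda>t. (pderiv ^^ k) (root_poly q m (z(j := z j + t)))"
    let ?x = "\<lambda>t. (z(j := z j + t)) i"
    let ?p' = "(pderiv ^^ k) (Polynomial.smult (- real (m j)) (cofactor_poly q m z j))"
    have fd: "(f i has_derivative frechet_derivative (f i) (at a)) (at (\<gamma> 0))"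
      using f[OF i] \<gamma>0 frechet_derivative_works by metis
    have "((f i \<circ> \<gamma>) has_derivative (frechet_derivative (f i) (at a) \<circ> (\<lambda>h. h *\<^sub>R v))) (at 0)"
      using v fd unfolding has_vector_derivative_def by (rule diff_chain_at)
    moreover have "frechet_derivative (f i) (at a) \<circ> (\<lambda>h. h *\<^sub>R v) = (*) (frechet_derivative (f i) (at a) v)"
      using linear_scale[OF has_derivative_linear[OF fd]] by (simp add: fun_eq_iff)
    ultimately have "((f i \<circ> \<gamma>) has_field_derivative frechet_derivative (f i) (at a) v) (at 0)"
      unfolding has_field_derivative_def by simp
    then have 1: "((\<lambda>t. poly (?P t) (?x t)) has_field_derivative frechet_derivative (f i) (at a) v) (at 0)"
    proof (rule has_field_derivative_transform_within_open)
      show "(f i \<circ> \<gamma>) t = poly (?P t) (?x t)" if "t \<in> {-\<epsilon><..<\<epsilon>}" for t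
      proof -
        have "\<gamma> t \<in> U" using \<gamma>T that by blast
        from feq[OF this mono[OF that] \<gamma> i] show ?thesis by simp
      qed
    qed (use \<epsilon> in auto)
    have "((\<lambda>t. poly (?P t) (?x t)) has_field_derivative
        poly ?p' (?x 0) + poly (pderiv (?P 0)) (?x 0) * (if i = j then 1 else 0)) (at 0)"
    proof (rule poly_has_derivative_of_coeff_derivative[where N = "CARD('n)"])
      show "has_coeff_derivative ?P ?p' 0"
        by (intro has_coeff_derivative_higher_pderiv has_coeff_derivative_root_poly j)
      show "degree (?P t) \<le> CARD('n)" for t
        using degree_higher_pderiv_le monic_root_poly(1) m(2) by metis
      have "cofactor_poly q m z j dvd root_poly q m z"
        using root_poly_eq_cofactor[OF j, where m = m] bspec[OF m(1) j] by (metis dvd_triv_right)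
      then have "degree (cofactor_poly q m z j) \<le> CARD('n)"
        unfolding m(2)[symmetric] monic_root_poly(1)[of q m z, symmetric]
        using splits_nonzero[OF splits_root_poly] by (rule dvd_imp_degree_le)
      then show "degree ?p' \<le> CARD('n)"
        by (meson degree_higher_pderiv_le degree_smult_le order_trans)
      show "(?x has_field_derivative (if i = j then 1 else 0)) (at 0)"
        by (cases "i = j") (auto intro!: derivative_eq_intros)
    qed
    from DERIV_unique[OF 1 this] show ?thesis
      unfolding higher_pderiv_smult poly_smult by simp
  qed
  ultimately show ?thesis by blast
qed

theorem proposition13:
  fixes e :: "nat \<Rightarrow> 'n::finite" and k q s :: nat and m :: "nat \<Rightarrow> nat" and G :: "real ^ 'n"
  assumes "bij_betw e {1..CARD('n)} UNIV"
    and "2 \<le> k" and "k \<le> CARD('n) - 1"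
    and "\<forall>i\<in>{1..q}. 0 < m i" and "(\<Sum>i=1..q. m i) = CARD('n)"
    and "\<forall>i\<in>{1..q}. m i < k"
    and "G \<in> stratum e q m"
    and "card {x. class_B k (monic_poly e G) x} = s"
  shows "\<exists>U V. open U \<and> G \<in> U \<and>
           discriminant_set e 0 k \<inter> stratum e q m \<inter> U = (\<Union>i\<in>{1..s}. V i) \<and>
           (\<forall>i\<in>{1..s}. smooth_hypersurface_of (stratum e q m \<inter> U) (V i)) \<and>
           transversal_at (stratum e q m \<inter> U) {1..s} V G"
proof -
  note e = assms(1) and m = assms(4,5) and mk = assms(6)
  let ?T = "stratum e q m"
  have k: "1 \<le> k" "k < (\<Sum>i=1..q. m i)"
    using assms(2,3) m(2) zero_less_card_finite[where 'a = 'n] by linarith+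
  obtain y where y: "strict_mono_on {1..q} y" "monic_poly e G = root_poly q m y"
    using assms(7) stratum_iff_root_poly[OF m] by blast
  have ord_y: "order (y i) (monic_poly e G) = m i" if "i \<in> {1..q}" for i
    unfolding y(2) using strict_mono_on_imp_inj_on[OF y(1)] that by (rule order_root_poly)
  have P0: "monic_poly e a \<noteq> 0" for a :: "real ^ 'n"
    using monic_monic_poly(2)[of e a] by auto
  have deg: "degree ((pderiv ^^ l) (monic_poly e a)) \<le> CARD('n)" for l and a :: "real ^ 'n"
    using degree_higher_pderiv_le monic_monic_poly(1) by metis
  have smooth_coeff: "Ck_on r S (\<lambda>a. coeff ((pderiv ^^ l) (monic_poly e a)) c)" if "open S" for r S l c
    using that by (intro Ck_on_coeff_higher_pderiv Ck_on_coeff_monic_poly)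
  \<comment> \<open>The data for each root: a neighbourhood \<open>W\<close> of \<open>G\<close>, an isolating radius \<open>\<delta>\<close>,
    and the smooth continuation \<open>\<phi>\<close> of \<open>y i\<close> as a simple root
    of the derivative of order \<open>m i - 1\<close>.\<close>
  define local_root where "local_root i X \<longleftrightarrow> (case X of (W, \<delta>, \<phi>) \<Rightarrow>
      open W \<and> G \<in> W \<and> 0 < \<delta> \<and> smooth_on W \<phi> \<and>
      (\<forall>a\<in>W. \<forall>x. \<bar>x - y i\<bar> \<le> \<delta> \<longrightarrow>
        poly ((pderiv ^^ (m i - 1)) (monic_poly e a)) x = 0 \<longrightarrow> x = \<phi> a))"
    for i and X :: "(real ^ 'n) set \<times> real \<times> (real ^ 'n \<Rightarrow> real)"
  have "\<exists>X. local_root i X" if i: "i \<in> {1..q}" for i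
  proof -
    have "m i - 1 \<le> order (y i) (monic_poly e G)" using ord_y[OF i] by simp
    from order_higher_pderiv[OF P0 this] have root: "poly ((pderiv ^^ (m i - 1)) (monic_poly e G)) (y i) = 0"
      using ord_y[OF i] bspec[OF m(1) i] by (simp add: order_root)
    have "pderiv ((pderiv ^^ (m i - 1)) (monic_poly e G)) = (pderiv ^^ m i) (monic_poly e G)"
      using bspec[OF m(1) i] by (cases "m i") auto
    then have simple: "poly (pderiv ((pderiv ^^ (m i - 1)) (monic_poly e G))) (y i) \<noteq> 0"
      using higher_pderiv_order_nonzero[OF P0, of "y i" G] ord_y[OF i] by simp
    obtain W \<delta> \<phi> where "open W" "G \<in> W" "0 < \<delta>" "smooth_on W \<phi>"
      "\<And>a x. a \<in> W \<Longrightarrow> \<bar>x - y i\<bar> \<le> \<delta> \<Longrightarrow>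
         poly ((pderiv ^^ (m i - 1)) (monic_poly e a)) x = 0 \<Longrightarrow> x = \<phi> a"
      by (rule smooth_simple_root[OF open_UNIV UNIV_I smooth_coeff[OF open_UNIV] deg root simple]) blast
    then have "local_root i (W, \<delta>, \<phi>)" by (simp add: local_root_def)
    then show ?thesis by blast
  qed
  then obtain X where X: "\<And>i. i \<in> {1..q} \<Longrightarrow> local_root i (X i)" by metis
  define W where "W i = fst (X i)" for i
  define \<delta> where "\<delta> i = fst (snd (X i))" for i
  define \<phi> where "\<phi> i = snd (snd (X i))" for i
  have W: "\<And>i. i \<in> {1..q} \<Longrightarrow> open (W i)" "\<And>i. i \<in> {1..q} \<Longrightarrow> G \<in> W i"
    and \<delta>: "\<And>i. i \<in> {1..q} \<Longrightarrow> 0 < \<delta> i"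
    and smooth\<phi>: "\<And>i. i \<in> {1..q} \<Longrightarrow> smooth_on (W i) (\<phi> i)"
    and \<phi>: "\<And>i a x. i \<in> {1..q} \<Longrightarrow> a \<in> W i \<Longrightarrow> \<bar>x - y i\<bar> \<le> \<delta> i \<Longrightarrow>
      poly ((pderiv ^^ (m i - 1)) (monic_poly e a)) x = 0 \<Longrightarrow> x = \<phi> i a"
    using X unfolding local_root_def case_prod_unfold W_def \<delta>_def \<phi>_def by blast+
  define \<epsilon> where "\<epsilon> = Min (insert 1 (\<delta> ` {1..q}))"
  have \<epsilon>: "0 < \<epsilon>" using \<delta> by (simp add: \<epsilon>_def)
  have \<epsilon>_le: "\<epsilon> \<le> \<delta> i" if "i \<in> {1..q}" for i
    unfolding \<epsilon>_def using that by (intro Min_le) auto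
  obtain U0 where U0: "open U0" "G \<in> U0"
    "\<And>a z i. a \<in> U0 \<Longrightarrow> strict_mono_on {1..q} z \<Longrightarrow> monic_poly e a = root_poly q m z \<Longrightarrow>
       i \<in> {1..q} \<Longrightarrow> \<bar>z i - y i\<bar> < \<epsilon>"
    using roots_continuous_on_stratum[OF e m y \<epsilon>] by blast
  define f where "f i a = poly ((pderiv ^^ k) (monic_poly e a)) (\<phi> i a)" for i a
  define B where "B = {i \<in> {1..q}. poly ((pderiv ^^ k) (monic_poly e G)) (y i) = 0}"
  define U1 where "U1 = U0 \<inter> (\<Inter>i\<in>{1..q}. W i)"
  \<comment> \<open>Besides isolating the roots, \<open>U\<close> avoids the zeros of those \<open>f i\<close> that do not vanish at \<open>G\<close>.\<close>
  define U where "U = (\<Inter>i\<in>{1..q} - B. U1 \<inter> f i -` (- {0})) \<inter> U1"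
  \<comment> \<open>On the stratum the continuation \<open>\<phi> i\<close> is the \<open>i\<close>-th root, so \<open>f i\<close> is the expected function there.\<close>
  have f_roots: "f i a = poly ((pderiv ^^ k) (root_poly q m z)) (z i)"
    if a: "a \<in> U1" and z: "strict_mono_on {1..q} z" "monic_poly e a = root_poly q m z" and i: "i \<in> {1..q}"
    for a z i
  proof -
    have "\<bar>z i - y i\<bar> \<le> \<delta> i"
      using U0(3)[OF _ z i] \<epsilon>_le[OF i] a by (auto simp: U1_def)
    moreover have "order (z i) (monic_poly e a) = m i"
      unfolding z(2) using strict_mono_on_imp_inj_on[OF z(1)] i by (rule order_root_poly)
    then have "poly ((pderiv ^^ (m i - 1)) (monic_poly e a)) (z i) = 0"
      using order_higher_pderiv[OF P0, of "m i - 1" "z i" a] bspec[OF m(1) i]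
      by (simp add: order_root)
    ultimately have "z i = \<phi> i a" using \<phi>[OF i] a i by (auto simp: U1_def)
    then show ?thesis by (simp add: f_def z(2))
  qed
  have "open U1" unfolding U1_def using U0(1) W(1) by (intro open_Int open_INT) auto
  have smoothf: "smooth_on U1 (f i)" if i: "i \<in> {1..q}" for i
    unfolding smooth_on_def
  proof (intro conjI allI \<open>open U1\<close>)
    fix r
    have "Ck_on r (W i) (\<phi> i)" using smooth\<phi>[OF i] unfolding smooth_on_def by blast
    moreover have "U1 \<subseteq> W i" unfolding U1_def using i by blast
    ultimately have "Ck_on r U1 (\<phi> i)" by (rule Ck_on_subset)
    then have "Ck_on r U1 (\<lambda>a. poly ((pderiv ^^ k) (monic_poly e a)) (\<phi> i a))"
      by (rule Ck_on_poly[OF \<open>open U1\<close> smooth_coeff[OF \<open>open U1\<close>] deg])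
    then show "Ck_on r U1 (f i)" unfolding f_def .
  qed
  have contf: "continuous_on U1 (f i)" if "i \<in> {1..q}" for i
    using smoothf[OF that] Ck_on_continuous unfolding smooth_on_def by blast
  have "open U"
    unfolding U_def using contf \<open>open U1\<close>
    by (intro open_Int open_INT ballI continuous_open_preimage) auto
  have G1: "G \<in> U1" using U0(2) W(2) by (auto simp: U1_def)
  have fG: "f i G = poly ((pderiv ^^ k) (monic_poly e G)) (y i)" if "i \<in> {1..q}" for i
    using f_roots[OF G1 y that] y(2) by simp
  have "G \<in> U" unfolding U_def using G1 fG by (auto simp: B_def)
  have UU1: "U \<subseteq> U1" unfolding U_def by blast
  have f_nonzero: "f i a \<noteq> 0" if "a \<in> U" "i \<in> {1..q}" "i \<notin> B" for i a
    using that unfolding U_def by blast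
  have Bq: "B \<subseteq> {1..q}" by (auto simp: B_def)
  have smoothU: "smooth_on U (f i)" if "i \<in> {1..q}" for i
    using smoothf[OF that] \<open>open U\<close> Ck_on_subset[OF _ UU1] unfolding smooth_on_def by blast
  have diff: "f i differentiable (at a)" if "i \<in> {1..q}" "a \<in> U" for i a
  proof -
    have "Ck_on (Suc 0) U (f i)" using smoothU[OF that(1)] unfolding smooth_on_def by blast
    then show ?thesis using that(2) by simp
  qed
  have fU: "f i a = poly ((pderiv ^^ k) (root_poly q m z)) (z i)"
    if "a \<in> U" "strict_mono_on {1..q} z" "monic_poly e a = root_poly q m z" "i \<in> {1..q}" for a z i
    using f_roots[OF subsetD[OF UU1 that(1)] that(2-4)] .
  \<comment> \<open>At every point of \<open>U\<close>, not just at \<open>G\<close>: a single index gives smoothness,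
    all class B indices at \<open>G\<close> give transversality.\<close>
  have indep: "\<forall>i\<in>B'. c i = 0"
    if a: "a \<in> ?T \<inter> U" and B': "B' \<subseteq> {1..q}" "\<And>i. i \<in> B' \<Longrightarrow> f i a = 0"
      and c: "\<And>v. v \<in> tangent_space (?T \<inter> U) a \<Longrightarrow> (\<Sum>i\<in>B'. c i * frechet_derivative (f i) (at a) v) = 0"
    for a B' and c :: "nat \<Rightarrow> real"
  proof -
    obtain z where z: "strict_mono_on {1..q} z" "monic_poly e a = root_poly q m z"
      using a stratum_iff_root_poly[OF m] by blast
    have aU: "a \<in> U" using a by blast
    show ?thesis
    proof (rule root_differentials_independent[OF m(1) mk k z(1) B'(1)])
      show "poly ((pderiv ^^ k) (root_poly q m z)) (z i) = 0" if "i \<in> B'" for i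
        using fU[OF aU z, of i] B' that by auto
      fix j assume j: "j \<in> {1..q}"
      obtain v where v: "v \<in> tangent_space (?T \<inter> U) a" "\<forall>i\<in>{1..q}. frechet_derivative (f i) (at a) v =
          (if i = j then poly ((pderiv ^^ Suc k) (root_poly q m z)) (z i) else 0)
          - real (m j) * poly ((pderiv ^^ k) (cofactor_poly q m z j)) (z i)"
        using root_equation_differential[OF e m z \<open>open U\<close> aU j diff[OF _ aU] fU] by blast
      show "(\<Sum>i\<in>B'. c i * ((if i = j then poly ((pderiv ^^ Suc k) (root_poly q m z)) (z i) else 0)
         - real (m j) * poly ((pderiv ^^ k) (cofactor_poly q m z j)) (z i))) = 0" (is "?s = 0")
      proof -
        have "?s = (\<Sum>i\<in>B'. c i * frechet_derivative (f i) (at a) v)"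
          using v(2) B'(1) by (intro sum.cong refl) (simp add: subset_iff)
        then show ?thesis using c[OF v(1)] by simp
      qed
    qed
  qed
  have classB: "{x. class_B k (monic_poly e G) x} = y ` B"
    unfolding class_B_def B_def using poly_root_poly_eq_0_iff[OF m(1), of y] ord_y mk y(2)
    by (auto simp: image_iff)
  have "inj_on y B"
    using strict_mono_on_imp_inj_on[OF y(1)] by (rule inj_on_subset) (auto simp: B_def)
  then have "card B = s" using assms(8) unfolding classB by (simp add: card_image)
  moreover have "finite B" by (simp add: B_def)
  ultimately obtain b where b: "bij_betw b {1..s} B"
    by (metis finite_same_card_bij card_atLeastAtMost diff_Suc_1 finite_atLeastAtMost)
  have bB: "b l \<in> B" if "l \<in> {1..s}" for l using b that by (auto simp: bij_betw_def)
  then have bq: "b l \<in> {1..q}" if "l \<in> {1..s}" for l using that by (auto simp: B_def)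
  define V where "V l = {a \<in> ?T \<inter> U. f (b l) a = 0}" for l
  have GV: "G \<in> V l" if "l \<in> {1..s}" for l
    using bB[OF that] fG[OF bq[OF that]] assms(7) \<open>G \<in> U\<close> by (simp add: V_def B_def)
  have ldef: "local_defining_equation (?T \<inter> U) (V l) a (f (b l))" if l: "l \<in> {1..s}" and a: "a \<in> V l" for l a
    unfolding local_defining_equation_def
  proof
    show "\<exists>W. a \<in> W \<and> smooth_on W (f (b l)) \<and> V l \<inter> W = {x \<in> ?T \<inter> U \<inter> W. f (b l) x = 0}"
      using a smoothU[OF bq[OF l]] by (intro exI[of _ U]) (auto simp: V_def)
    show "\<exists>v\<in>tangent_space (?T \<inter> U) a. frechet_derivative (f (b l)) (at a) v \<noteq> 0"
      using indep[of a "{b l}" "\<lambda>_. 1"] a bq[OF l] by (auto simp: V_def)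
  qed
  have "discriminant_set e 0 k \<inter> ?T \<inter> U = (\<Union>l\<in>{1..s}. V l)"
  proof -
    have "a \<in> discriminant_set e 0 k \<longleftrightarrow> (\<exists>l\<in>{1..s}. f (b l) a = 0)" if a: "a \<in> ?T \<inter> U" for a
    proof -
      obtain z where z: "strict_mono_on {1..q} z" "monic_poly e a = root_poly q m z"
        using a stratum_iff_root_poly[OF m] by blast
      have "a \<in> discriminant_set e 0 k \<longleftrightarrow> (\<exists>i\<in>{1..q}. poly ((pderiv ^^ k) (root_poly q m z)) (z i) = 0)"
        unfolding discriminant_set_def z(2)[symmetric]
        using resultant_root_poly_eq_0_iff[OF m(1), of z] z(2) by simp
      also have "\<dots> \<longleftrightarrow> (\<exists>i\<in>{1..q}. f i a = 0)" using fU[OF _ z] a by auto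
      also have "\<dots> \<longleftrightarrow> (\<exists>i\<in>B. f i a = 0)" using f_nonzero Bq a by blast
      also have "\<dots> \<longleftrightarrow> (\<exists>l\<in>{1..s}. f (b l) a = 0)" using b by (auto simp: bij_betw_def)
      finally show ?thesis .
    qed
    then show ?thesis by (auto simp: V_def)
  qed
  moreover have "smooth_hypersurface_of (?T \<inter> U) (V l)" if l: "l \<in> {1..s}" for l
    unfolding smooth_hypersurface_of_def
  proof (intro conjI ballI)
    show "V l \<subseteq> ?T \<inter> U" by (auto simp: V_def)
    have Vl: "V l = (?T \<inter> U) \<inter> f (b l) -` {0}" by (auto simp: V_def)
    have "continuous_on (?T \<inter> U) (f (b l))"
      using contf[OF bq[OF l]] by (rule continuous_on_subset) (use UU1 in blast)
    then show "closedin (top_of_set (?T \<inter> U)) (V l)"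
      unfolding Vl by (intro continuous_closedin_preimage closed_singleton)
    show "\<exists>f. local_defining_equation (?T \<inter> U) (V l) a f" if "a \<in> V l" for a
      using ldef[OF l that] by blast
  qed
  moreover have "transversal_at (?T \<inter> U) {1..s} V G"
    unfolding transversal_at_def
  proof (intro conjI ballI exI[of _ "\<lambda>l. f (b l)"] allI impI)
    show "G \<in> V l" if "l \<in> {1..s}" for l using GV[OF that] .
    show "local_defining_equation (?T \<inter> U) (V l) G (f (b l))" if "l \<in> {1..s}" for l
      using ldef[OF that GV[OF that]] .
    fix c :: "nat \<Rightarrow> real" and l
    assume c: "\<forall>v\<in>tangent_space (?T \<inter> U) G. (\<Sum>l\<in>{1..s}. c l * frechet_derivative (f (b l)) (at G) v) = 0"
      and l: "l \<in> {1..s}"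
    \<comment> \<open>The coefficients, reindexed from \<open>{1..s}\<close> to the class B roots.\<close>
    define c' where "c' i = c (inv_into {1..s} b i)" for i
    have c': "c' (b l) = c l" if "l \<in> {1..s}" for l
      using that b by (simp add: c'_def bij_betw_def)
    have "(\<Sum>i\<in>B. c' i * frechet_derivative (f i) (at G) v)
        = (\<Sum>l\<in>{1..s}. c l * frechet_derivative (f (b l)) (at G) v)" for v
      unfolding sum.reindex_bij_betw[OF b, symmetric] by (intro sum.cong refl) (simp add: c')
    then have "\<forall>i\<in>B. c' i = 0"
      using c assms(7) \<open>G \<in> U\<close> fG by (intro indep[of G]) (auto simp: B_def)
    then show "c l = 0" using bB[OF l] c'[OF l] by metis
  qed
  ultimately show ?thesis
    using \<open>open U\<close> \<open>G \<in> U\<close> by (intro exI[of _ U] exI[of _ V]) blast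
qed

end
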